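(* Let $X$ be a separable operator space and assume that $X$ almost completely isometrically embeds into an operator space $Y$. Then $X$ almost completely $\mathbb{R}$-linearly isometrically embeds into $Y$.
   Context: An operator space is a closed $\mathbb{C}$-linear subspace $X\subset \mathcal{B}(H)$ for a (complex) Hilbert space $H$; $\mathrm{M}_n(X)$ carries the norm inherited from $\mathcal{B}(H^{\oplus n})$, where $H^{\oplus n}$ is the $\ell_2$-sum of $n$ copies of $H$. For a map $f:X\to Y$ (not necessarily linear), the $n$-th amplification is $f_n:\mathrm{M}_n(X)\to \mathrm{M}_n(Y)$, $f_n([x_{ij}])=[f(x_{ij})]$. $X$ almost completely isometrically embeds into $Y$ if there is a sequence of (arbitrary) maps $(f^n:X\to Y)_{n\in\mathbb{N}}$ such that for each $n$ the $n$-th amplification $f^n_n:\mathrm{M}_n(X)\to\mathrm{M}_n(Y)$ of $f^n$ is an isometry (distance preserving, not assumed onto). $X$ almost completely $\mathbb{R}$-linearly isometrically embeds into $Y$ if such a sequence exists in which, in addition, each $f^n$ is $\mathbb{R}$-linear. *)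

theory Defs
  imports "HOL-Analysis.Analysis"
begin

text \<open>
  Complex Hilbert spaces. The inner product is conjugate-linear in the first and linear in the
  second argument; \<open>scaleR\<close>, the norm and completeness come from \<^class>\<open>banach\<close>.
\<close>

class chilbert_space = banach +
  fixes scaleC :: "complex \<Rightarrow> 'a \<Rightarrow> 'a" (infixr "*\<^sub>C" 75)
    and cinner :: "'a \<Rightarrow> 'a \<Rightarrow> complex"
  assumes scaleC_add_right: "a *\<^sub>C (x + y) = a *\<^sub>C x + a *\<^sub>C y"
    and scaleC_add_left: "(a + b) *\<^sub>C x = a *\<^sub>C x + b *\<^sub>C x"
    and scaleC_scaleC: "a *\<^sub>C b *\<^sub>C x = (a * b) *\<^sub>C x"
    and scaleC_of_real: "complex_of_real r *\<^sub>C x = r *\<^sub>R x"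
    and cinner_commute: "cinner x y = cnj (cinner y x)"
    and cinner_add_right: "cinner x (y + z) = cinner x y + cinner x z"
    and cinner_scaleC_right: "cinner x (a *\<^sub>C y) = a * cinner x y"
    and cinner_norm_sq: "cinner x x = complex_of_real ((norm x)\<^sup>2)"

instantiation complex :: chilbert_space
begin

definition scaleC_complex :: "complex \<Rightarrow> complex \<Rightarrow> complex"
  where "scaleC_complex a x = a * x"

definition cinner_complex :: "complex \<Rightarrow> complex \<Rightarrow> complex"
  where "cinner_complex x y = cnj x * y"

instance
proof
  fix x :: complex
  show "cinner x x = complex_of_real ((norm x)\<^sup>2)"
    by (metis cinner_complex_def complex_norm_square mult.commute)
qed (simp_all add: scaleC_complex_def cinner_complex_def ring_distribs scaleR_conv_of_real)

end

lemma norm_scaleC: "norm (a *\<^sub>C x) = cmod a * norm (x :: 'h::chilbert_space)"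
proof -
  have "complex_of_real ((norm (a *\<^sub>C x))\<^sup>2) = a * cinner (a *\<^sub>C x) x"
    by (metis cinner_norm_sq cinner_scaleC_right)
  also have "\<dots> = a * cnj (a * cinner x x)"
    by (metis cinner_commute cinner_scaleC_right)
  also have "\<dots> = (a * cnj a) * cnj (cinner x x)"
    by (simp only: complex_cnj_mult mult.assoc)
  also have "\<dots> = complex_of_real ((cmod a)\<^sup>2) * complex_of_real ((norm x)\<^sup>2)"
    by (simp only: cinner_norm_sq complex_norm_square complex_cnj_complex_of_real)
  also have "\<dots> = complex_of_real ((cmod a * norm x)\<^sup>2)"
    by (simp only: of_real_mult power_mult_distrib)
  finally have "(norm (a *\<^sub>C x))\<^sup>2 = (cmod a * norm x)\<^sup>2"
    using of_real_eq_iff by blast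
  then show ?thesis
    by (simp add: power2_eq_iff_nonneg)
qed

lemma bounded_linear_scaleC: "bounded_linear (\<lambda>x :: 'h::chilbert_space. a *\<^sub>C x)"
proof (rule bounded_linear_intro[where K = "cmod a"])
  fix r :: real and x y :: 'h
  show "a *\<^sub>C (x + y) = a *\<^sub>C x + a *\<^sub>C y"
    by (rule scaleC_add_right)
  show "a *\<^sub>C r *\<^sub>R x = r *\<^sub>R a *\<^sub>C x"
    by (metis scaleC_of_real scaleC_scaleC mult.commute)
  show "norm (a *\<^sub>C x) \<le> norm x * cmod a"
    by (simp add: norm_scaleC)
qed

text \<open>
  \<open>\<B>(H)\<close> is the set of complex-linear elements of the type \<open>'h \<Rightarrow>\<^sub>L 'h\<close> of bounded real-linear
  operators; the norm of \<open>'h \<Rightarrow>\<^sub>L 'h\<close> is the usual operator norm.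
\<close>

definition bounded_clinear_ops :: "('h::chilbert_space \<Rightarrow>\<^sub>L 'h) set"
  where "bounded_clinear_ops = {T. \<forall>c x. blinfun_apply T (c *\<^sub>C x) = c *\<^sub>C blinfun_apply T x}"

definition scaleC_op :: "complex \<Rightarrow> ('h::chilbert_space \<Rightarrow>\<^sub>L 'h) \<Rightarrow> ('h \<Rightarrow>\<^sub>L 'h)"
  where "scaleC_op c T = Blinfun (\<lambda>x. c *\<^sub>C blinfun_apply T x)"

lemma scaleC_op_apply: "blinfun_apply (scaleC_op c T) x = c *\<^sub>C blinfun_apply T x"
  unfolding scaleC_op_def
  by (subst bounded_linear_Blinfun_apply)
    (auto intro: bounded_linear_compose[OF bounded_linear_scaleC] blinfun.bounded_linear_right)

definition operator_space :: "('h::chilbert_space \<Rightarrow>\<^sub>L 'h) set \<Rightarrow> bool"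
  where "operator_space X \<longleftrightarrow>
    X \<subseteq> bounded_clinear_ops \<and> closed X \<and> 0 \<in> X \<and>
    (\<forall>S\<in>X. \<forall>T\<in>X. S + T \<in> X) \<and> (\<forall>c. \<forall>T\<in>X. scaleC_op c T \<in> X)"

text \<open>
  An \<open>n \<times> n\<close> matrix is a function of two indices of which only the entries with both indices
  below \<open>n\<close> are relevant; likewise a vector of \<open>H\<^sup>\<oplus>\<^sup>n\<close> is a function \<open>\<xi>\<close> whose entries below \<open>n\<close> are
  relevant, with \<open>\<ell>\<^sub>2\<close>-norm \<open>L2_set (\<lambda>i. norm (\<xi> i)) {..<n}\<close>.
\<close>

definition mats :: "nat \<Rightarrow> 'a set \<Rightarrow> (nat \<Rightarrow> nat \<Rightarrow> 'a) set"
  where "mats n X = {x. \<forall>i<n. \<forall>j<n. x i j \<in> X}"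

definition sum_norm :: "nat \<Rightarrow> (nat \<Rightarrow> 'h::chilbert_space) \<Rightarrow> real"
  where "sum_norm n \<xi> = L2_set (\<lambda>i. norm (\<xi> i)) {..<n}"

definition mat_apply ::
    "nat \<Rightarrow> (nat \<Rightarrow> nat \<Rightarrow> ('h::chilbert_space \<Rightarrow>\<^sub>L 'h)) \<Rightarrow> (nat \<Rightarrow> 'h) \<Rightarrow> (nat \<Rightarrow> 'h)"
  where "mat_apply n x \<xi> = (\<lambda>i. \<Sum>j<n. blinfun_apply (x i j) (\<xi> j))"

definition mat_norm :: "nat \<Rightarrow> (nat \<Rightarrow> nat \<Rightarrow> ('h::chilbert_space \<Rightarrow>\<^sub>L 'h)) \<Rightarrow> real"
  where "mat_norm n x = (SUP \<xi>\<in>{\<xi>. sum_norm n \<xi> \<le> 1}. sum_norm n (mat_apply n x \<xi>))"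

lemma bdd_above_mat_norm:
  "bdd_above ((\<lambda>\<xi>. sum_norm n (mat_apply n x \<xi>)) ` {\<xi>. sum_norm n \<xi> \<le> 1})"
proof (rule bdd_aboveI2)
  fix \<xi> :: "nat \<Rightarrow> 'a" assume "\<xi> \<in> {\<xi>. sum_norm n \<xi> \<le> 1}"
  then have \<xi>: "norm (\<xi> j) \<le> 1" if "j < n" for j
    using member_le_L2_set[of "{..<n}" j "\<lambda>i. norm (\<xi> i)"] that
    by (simp add: sum_norm_def)
  have "norm (mat_apply n x \<xi> i) \<le> (\<Sum>j<n. norm (x i j))" for i
    unfolding mat_apply_def
  proof (intro order.trans[OF norm_sum] sum_mono)
    fix j assume "j \<in> {..<n}"
    then show "norm (blinfun_apply (x i j) (\<xi> j)) \<le> norm (x i j)"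
      using norm_blinfun[of "x i j" "\<xi> j"] \<xi>[of j] mult_left_le[of "norm (\<xi> j)" "norm (x i j)"]
      by simp
  qed
  then have "(\<Sum>i<n. norm (mat_apply n x \<xi> i)) \<le> (\<Sum>i<n. \<Sum>j<n. norm (x i j))"
    by (intro sum_mono)
  then show "sum_norm n (mat_apply n x \<xi>) \<le> (\<Sum>i<n. \<Sum>j<n. norm (x i j))"
    unfolding sum_norm_def
    by (intro order.trans[OF L2_set_le_sum]) auto
qed

definition amplification :: "('a \<Rightarrow> 'b) \<Rightarrow> (nat \<Rightarrow> nat \<Rightarrow> 'a) \<Rightarrow> (nat \<Rightarrow> nat \<Rightarrow> 'b)"
  where "amplification f x = (\<lambda>i j. f (x i j))"

definition amplification_isometric ::
    "nat \<Rightarrow> ('h::chilbert_space \<Rightarrow>\<^sub>L 'h) set \<Rightarrow> (('h \<Rightarrow>\<^sub>L 'h) \<Rightarrow> ('k::chilbert_space \<Rightarrow>\<^sub>L 'k)) \<Rightarrow> bool"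
  where "amplification_isometric n X f \<longleftrightarrow>
    (\<forall>x\<in>mats n X. \<forall>y\<in>mats n X.
      mat_norm n (\<lambda>i j. amplification f x i j - amplification f y i j)
        = mat_norm n (\<lambda>i j. x i j - y i j))"

definition real_linear_on :: "'a::real_vector set \<Rightarrow> ('a \<Rightarrow> 'b::real_vector) \<Rightarrow> bool"
  where "real_linear_on X f \<longleftrightarrow>
    (\<forall>x\<in>X. \<forall>y\<in>X. f (x + y) = f x + f y) \<and> (\<forall>r. \<forall>x\<in>X. f (r *\<^sub>R x) = r *\<^sub>R f x)"

text \<open>Maps \<open>X \<rightarrow> Y\<close> are total functions on the operator type, with irrelevant values outside \<open>X\<close>.\<close>

definition almost_completely_isometrically_embeds ::
    "('h::chilbert_space \<Rightarrow>\<^sub>L 'h) set \<Rightarrow> ('k::chilbert_space \<Rightarrow>\<^sub>L 'k) set \<Rightarrow> bool"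
  where "almost_completely_isometrically_embeds X Y \<longleftrightarrow>
    (\<exists>f :: nat \<Rightarrow> ('h \<Rightarrow>\<^sub>L 'h) \<Rightarrow> ('k \<Rightarrow>\<^sub>L 'k).
      \<forall>n\<ge>1. f n \<in> X \<rightarrow> Y \<and> amplification_isometric n X (f n))"

definition almost_completely_real_linearly_isometrically_embeds ::
    "('h::chilbert_space \<Rightarrow>\<^sub>L 'h) set \<Rightarrow> ('k::chilbert_space \<Rightarrow>\<^sub>L 'k) set \<Rightarrow> bool"
  where "almost_completely_real_linearly_isometrically_embeds X Y \<longleftrightarrow>
    (\<exists>f :: nat \<Rightarrow> ('h \<Rightarrow>\<^sub>L 'h) \<Rightarrow> ('k \<Rightarrow>\<^sub>L 'k).
      \<forall>n\<ge>1. f n \<in> X \<rightarrow> Y \<and> amplification_isometric n X (f n) \<and> real_linear_on X (f n))"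

end

theory Submission
  imports Defs "HOL-Library.Function_Algebras"
begin

text \<open>
  For each \<open>n\<close> separately, the given map \<open>f : X \<rightarrow> Y\<close> with isometric \<open>n\<close>-th amplification is smoothed
  and then differentiated at the origin; the derivative is real-linear and still has an isometric
  \<open>n\<close>-th amplification.
  
  That smoothing does no harm rests on the lemma \<open>isometry_add_translates\<close>: the midpoint
  \<open>v \<mapsto> (f v + f (v + b)) / 2\<close> of two translates of an isometry between seminormed spaces is again an
  isometry. The reason is the one behind Figiel's theorem. A functional \<open>g\<close> that norms
  \<open>f (v + m x) - f (v - m x)\<close> for a large \<open>m\<close> must make \<open>g \<circ> f\<close> grow at full speed along the line
  through \<open>v\<close> in direction \<open>x\<close>, and, when the norm is differentiable at \<open>x\<close> in direction \<open>b\<close>, along the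
  parallel line through \<open>v + b\<close> as well; so one functional norms both increments and their norms add
  up. The norm is differentiable at \<open>x\<close> in a single prescribed direction, up to any given error,
  after an arbitrarily small change of \<open>x\<close>. The lemma is applied to the \<open>n\<close>-th amplification and to
  translations by constant matrices.
  
  Hence the class of maps \<open>X \<rightarrow> Y\<close> with isometric \<open>n\<close>-th amplification is closed under midpoints of
  translates, under pointwise limits and under passing to difference quotients at the origin. By
  repeated halving it is closed under the averages \<open>\<integral>\<^sub>0\<^sup>1 F (v + t a) dt\<close> (\<open>avg_isos\<close>), and such an
  average is differentiable in direction \<open>a\<close>, with an error bound that later averages and limits
  preserve. Averaging successively along short multiples \<open>a\<^sub>k\<close> of a dense sequence of \<open>X\<close> therefore
  converges to a map \<open>G\<close> of the class that is strictly differentiable at the origin along every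
  \<open>a\<^sub>k\<close>. The directions of strict differentiability form a closed real subspace, here all of \<open>X\<close>, and
  the derivative is linear in the direction. Being a pointwise limit of difference quotients of
  \<open>G\<close>, it lies in the class too.
\<close>

section \<open>Midpoints of translates of an isometry\<close>

locale seminorm =
  fixes p :: "'a::real_vector \<Rightarrow> real"
  assumes triangle: "p (x + y) \<le> p x + p y"
    and scale: "p (r *\<^sub>R x) = \<bar>r\<bar> * p x"
begin

lemma zero [simp]: "p 0 = 0"
  using scale[of 0 0] by simp

lemma minus [simp]: "p (- x) = p x"
  using scale[of "-1" x] by simp

lemma minus_commute: "p (x - y) = p (y - x)"
  using minus[of "x - y"] by simp

lemma nonneg: "0 \<le> p x"
  using triangle[of x "- x"] by simp

lemma diff_le: "\<bar>p x - p y\<bar> \<le> p (x - y)"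
  using triangle[of "x - y" y] triangle[of "y - x" x] minus_commute[of x y] by simp

end

text \<open>
  The second differences of step \<open>\<delta>\<close> at the points \<open>\<delta>, 2\<delta>, \<dots>, K\<delta>\<close> telescope to a difference of two
  increments, which is at most \<open>2 L \<delta>\<close>. If each of them exceeded \<open>e \<delta>\<close>, then \<open>K\<close> would be bounded
  by \<open>2 L / e\<close>.
\<close>

lemma lipschitz_has_small_second_difference:
  fixes q :: "real \<Rightarrow> real"
  assumes lip: "\<And>s t. \<bar>q s - q t\<bar> \<le> L * \<bar>s - t\<bar>" and "e > 0" "r > 0"
  obtains s \<delta> where "0 \<le> s" "s \<le> r" "\<delta> > 0" "q (s + \<delta>) + q (s - \<delta>) \<le> 2 * q s + e * \<delta>"
proof -
  have L: "0 \<le> L"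
    using lip[of 0 1] by simp
  obtain K :: nat where K: "2 * L / e < K"
    using reals_Archimedean2 by blast
  then have KL: "2 * L < real K * e"
    using \<open>e > 0\<close> by (simp add: pos_divide_less_eq)
  then have "K > 0"
    using L by (intro gr0I) auto
  define \<delta> where "\<delta> = r / (K + 1)"
  have \<delta>: "\<delta> > 0" "(real K + 1) * \<delta> = r"
    using \<open>r > 0\<close> by (auto simp: \<delta>_def divide_simps)
  define a where "a j = q (real (Suc j) * \<delta>) - q (real j * \<delta>)" for j
  have bound: "\<bar>a j\<bar> \<le> L * \<delta>" for j
  proof -
    have "\<bar>a j\<bar> \<le> L * \<bar>real (Suc j) * \<delta> - real j * \<delta>\<bar>"
      unfolding a_def by (rule lip)
    also have "real (Suc j) * \<delta> - real j * \<delta> = \<delta>"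
      by (simp add: algebra_simps)
    finally show ?thesis
      using \<delta> by simp
  qed
  have "\<exists>j<K. a (Suc j) - a j \<le> e * \<delta>"
  proof (rule ccontr)
    assume "\<not> ?thesis"
    then have "(\<Sum>j<K. e * \<delta>) \<le> (\<Sum>j<K. a (Suc j) - a j)"
      by (intro sum_mono) (auto simp: not_le intro: less_imp_le)
    also have "\<dots> = a K - a 0"
      by (rule sum_lessThan_telescope)
    also have "\<dots> \<le> (2 * L) * \<delta>"
      using bound[of K] bound[of 0] by linarith
    also have "\<dots> < (real K * e) * \<delta>"
      using KL \<delta> by simp
    finally show False
      by simp
  qed
  then obtain j where j: "j < K" "a (Suc j) - a j \<le> e * \<delta>"
    by blast
  show thesis
  proof (rule that[of "real (Suc j) * \<delta>" \<delta>])
    show "0 \<le> real (Suc j) * \<delta>"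
      using \<delta> by simp
    have "real (Suc j) * \<delta> \<le> (real K + 1) * \<delta>"
      using j \<delta> by (intro mult_right_mono) auto
    then show "real (Suc j) * \<delta> \<le> r"
      using \<delta> by simp
    have "real (Suc (Suc j)) * \<delta> = real (Suc j) * \<delta> + \<delta>" "real j * \<delta> = real (Suc j) * \<delta> - \<delta>"
      by (simp_all add: algebra_simps)
    then show "q (real (Suc j) * \<delta> + \<delta>) + q (real (Suc j) * \<delta> - \<delta>) \<le> 2 * q (real (Suc j) * \<delta>) + e * \<delta>"
      using j(2) unfolding a_def by simp
  qed (use \<delta> in auto)
qed

text \<open>
  With \<open>y = x + s b\<close> and \<open>h = 1 / k\<close>, the last inequality reads
  \<open>p (y + h b) + p (y - h b) - 2 p y \<le> e h\<close>: at \<open>y\<close> the two one-sided derivatives of the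
  seminorm in direction \<open>b\<close> differ by at most \<open>e\<close>. The homogeneous form is the one that the
  estimates along long segments use.
\<close>

lemma (in seminorm) almost_smooth_point_nearby:
  assumes "e > 0"
  obtains s k where "p (s *\<^sub>R b) \<le> e" "k > 0"
    "p (k *\<^sub>R (x + s *\<^sub>R b) + b) + p (k *\<^sub>R (x + s *\<^sub>R b) - b) \<le> 2 * k * p (x + s *\<^sub>R b) + e"
proof -
  have "\<bar>p (x + s *\<^sub>R b) - p (x + t *\<^sub>R b)\<bar> \<le> p b * \<bar>s - t\<bar>" for s t
    using diff_le[of "x + s *\<^sub>R b" "x + t *\<^sub>R b"] scale[of "s - t" b]
    by (simp add: algebra_simps)
  moreover have "0 < e / (p b + 1)"
    using assms nonneg[of b] by simp
  ultimately obtain s \<delta> where s: "0 \<le> s" "s \<le> e / (p b + 1)" and \<delta>: "\<delta> > 0"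
    and *: "p (x + (s + \<delta>) *\<^sub>R b) + p (x + (s - \<delta>) *\<^sub>R b) \<le> 2 * p (x + s *\<^sub>R b) + e * \<delta>"
    using lipschitz_has_small_second_difference[of "\<lambda>s. p (x + s *\<^sub>R b)" "p b" e] assms by metis
  define k where "k = 1 / \<delta>"
  have k: "k > 0" "k * \<delta> = 1"
    using \<delta> by (auto simp: k_def)
  have up: "k *\<^sub>R (x + s *\<^sub>R b) + b = k *\<^sub>R (x + (s + \<delta>) *\<^sub>R b)"
    using k(2) by (simp add: algebra_simps)
  have down: "k *\<^sub>R (x + s *\<^sub>R b) - b = k *\<^sub>R (x + (s - \<delta>) *\<^sub>R b)"
    using k(2) by (simp add: algebra_simps)
  have "k * (p (x + (s + \<delta>) *\<^sub>R b) + p (x + (s - \<delta>) *\<^sub>R b)) \<le> k * (2 * p (x + s *\<^sub>R b) + e * \<delta>)"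
    using * k by (intro mult_left_mono) auto
  also have "\<dots> = 2 * k * p (x + s *\<^sub>R b) + e * (k * \<delta>)"
    by (simp add: algebra_simps)
  finally have main: "p (k *\<^sub>R (x + s *\<^sub>R b) + b) + p (k *\<^sub>R (x + s *\<^sub>R b) - b)
      \<le> 2 * k * p (x + s *\<^sub>R b) + e"
    unfolding up down scale using k by (simp add: distrib_left)
  have "p (s *\<^sub>R b) \<le> s * (p b + 1)"
    unfolding scale using s(1) nonneg[of b] by (simp add: algebra_simps)
  also have "\<dots> \<le> e"
    using s(2) nonneg[of b] by (simp add: le_divide_eq add_nonneg_pos)
  finally show thesis
    using that main k by blast
qed

locale normed_by_functionals = seminorm P for P :: "'b::real_vector \<Rightarrow> real" +
  assumes almost_norming: "e > 0 \<Longrightarrow> \<exists>g. linear g \<and> (\<forall>w. g w \<le> P w) \<and> P w - e \<le> g w"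

text \<open>
  The map \<open>z \<mapsto> f z + f (z + b)\<close> expands distances exactly by the factor \<open>2\<close>. Replace \<open>u - v\<close> by a
  nearby almost smooth \<open>x\<close>, and let \<open>g\<close> almost norm \<open>top - bot\<close>, the difference of the images of
  \<open>v + m x\<close> and \<open>v - m x\<close>. As \<open>f\<close> preserves distances and \<open>g\<close> is bounded by the norm, \<open>g (f z)\<close>
  is bounded below by \<open>g top\<close> minus the distance of \<open>z\<close> to \<open>v + m x\<close>, and above by \<open>g bot\<close> plus
  its distance to \<open>v - m x\<close>. For \<open>z = v + x, v\<close> these bounds show that \<open>g \<circ> f\<close>
  grows from \<open>v\<close> to \<open>v + x\<close> by almost the norm of \<open>x\<close>. The same holds from \<open>v + b\<close> to \<open>v + x + b\<close>:
  there the distances involve \<open>k x - b\<close> and \<open>k x + b\<close>, whose norms together exceed \<open>2 k\<close> times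
  that of \<open>x\<close> by at most a small error, by the choice of \<open>x\<close>.
\<close>

lemma isometry_add_translates:
  fixes p :: "'a::real_vector \<Rightarrow> real" and P :: "'b::real_vector \<Rightarrow> real"
  assumes "seminorm p" and "normed_by_functionals P"
    and iso: "\<And>x y. x \<in> S \<Longrightarrow> y \<in> S \<Longrightarrow> P (f x - f y) = p (x - y)"
    and "subspace S"
    and S: "u \<in> S" "v \<in> S" "b \<in> S"
  shows "P ((f u - f v) + (f (u + b) - f (v + b))) = 2 * p (u - v)"
proof (rule antisym)
  note add = subspace_add[OF \<open>subspace S\<close>] and scl = subspace_scale[OF \<open>subspace S\<close>]
  interpret p: seminorm p by fact
  interpret P: normed_by_functionals P by fact
  have "P ((f u - f v) + (f (u + b) - f (v + b))) \<le> P (f u - f v) + P (f (u + b) - f (v + b))"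
    by (rule P.triangle)
  also have "\<dots> = 2 * p (u - v)"
    using S by (simp add: iso add)
  finally show "P ((f u - f v) + (f (u + b) - f (v + b))) \<le> 2 * p (u - v)" .
  show "2 * p (u - v) \<le> P ((f u - f v) + (f (u + b) - f (v + b)))"
  proof (rule field_le_epsilon)
    fix e' :: real assume "0 < e'"
    \<comment> \<open>three errors from \<open>g\<close> and the smoothness of \<open>x\<close>, two from replacing \<open>u\<close> by \<open>v + x\<close> in the
      sum, and two from comparing \<open>2 N\<close> with \<open>2 p (u - v)\<close>\<close>
    define e where "e = e' / 7"
    have e: "0 < e"
      using \<open>0 < e'\<close> by (simp add: e_def)
    obtain s k where s: "p (s *\<^sub>R b) \<le> e" and "k > 0" and
      smooth: "p (k *\<^sub>R ((u - v) + s *\<^sub>R b) + b) + p (k *\<^sub>R ((u - v) + s *\<^sub>R b) - b)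
        \<le> 2 * k * p ((u - v) + s *\<^sub>R b) + e"
      using p.almost_smooth_point_nearby[OF e, of b "u - v"] by metis
    define x where "x = (u - v) + s *\<^sub>R b"
    note smooth = smooth[folded x_def]
    define N where "N = p x"
    \<comment> \<open>the segment is one step \<open>x\<close> longer than \<open>k x\<close>, so that seen from \<open>v + x + b\<close> its upper
      end is at \<open>k x - b\<close>\<close>
    define m where "m = k + 1"
    have "u - v \<in> S"
      using add[OF S(1) scl[OF S(2), of "-1"]] by simp
    then have x: "x \<in> S"
      unfolding x_def using add scl S by blast
    define top bot where "top = f (v + m *\<^sub>R x)" and "bot = f (v - m *\<^sub>R x)"
    have mem: "v + r *\<^sub>R x \<in> S" "v - r *\<^sub>R x \<in> S" for r
      using add[OF S(2) scl[OF x, of r]] add[OF S(2) scl[OF x, of "-r"]] by auto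
    obtain g where g: "linear g" "\<And>w. g w \<le> P w" and gtop: "P (top - bot) - e \<le> g (top - bot)"
      using P.almost_norming[OF e, of "top - bot"] by auto
    have gdiff: "g (y - z) = g y - g z" for y z
      by (rule linear_diff[OF g(1)])
    have gadd: "g (y + z) = g y + g z" for y z
      by (rule linear_add[OF g(1)])
    have "P (top - bot) = p ((2 * m) *\<^sub>R x)"
      unfolding top_def bot_def iso[OF mem(1) mem(2)] by (simp add: algebra_simps flip: scaleR_left_distrib)
    then have long: "2 * m * N - e \<le> g top - g bot"
      using gtop \<open>k > 0\<close> by (simp add: p.scale gdiff m_def N_def)
    have lower: "g top - p (v + m *\<^sub>R x - z) \<le> g (f z)" if "z \<in> S" for z
      using g(2)[of "top - f z"] iso[OF mem(1)[of m] that] by (simp add: gdiff top_def)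
    have upper: "g (f z) \<le> g bot + p (z - (v - m *\<^sub>R x))" if "z \<in> S" for z
      using g(2)[of "f z - bot"] iso[OF that mem(2)[of m]] by (simp add: gdiff bot_def)
    have vx: "v + x \<in> S" "v + x + b \<in> S" "v + b \<in> S"
      using add S x by auto
    have 1: "N - e \<le> g (f (v + x)) - g (f v)"
    proof -
      have "v + m *\<^sub>R x - (v + x) = k *\<^sub>R x"
        by (simp add: m_def algebra_simps)
      then have "g top - k * N \<le> g (f (v + x))"
        using lower[OF vx(1)] \<open>k > 0\<close> by (simp add: N_def p.scale)
      moreover have "g (f v) \<le> g bot + m * N"
        using upper[OF S(2)] \<open>k > 0\<close> by (simp add: m_def N_def p.scale)
      ultimately show ?thesis
        using long by (simp add: m_def algebra_simps)
    qed
    have 2: "N - 2 * e \<le> g (f (v + x + b)) - g (f (v + b))"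
    proof -
      have "v + m *\<^sub>R x - (v + x + b) = k *\<^sub>R x - b"
        by (simp add: m_def algebra_simps)
      then have "g top - p (k *\<^sub>R x - b) \<le> g (f (v + x + b))"
        using lower[OF vx(2)] by (simp only:)
      moreover have "g (f (v + b)) \<le> g bot + (p (k *\<^sub>R x + b) + N)"
      proof -
        have "v + b - (v - m *\<^sub>R x) = (k *\<^sub>R x + b) + x"
          by (simp add: m_def algebra_simps)
        then have "p (v + b - (v - m *\<^sub>R x)) \<le> p (k *\<^sub>R x + b) + N"
          unfolding N_def by (simp only: p.triangle)
        then show ?thesis
          using upper[OF vx(3)] by linarith
      qed
      ultimately show ?thesis
        using long smooth by (simp add: m_def N_def algebra_simps)
    qed
    let ?D = "(f (v + x) - f v) + (f (v + x + b) - f (v + b))"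
    let ?E = "(f u - f v) + (f (u + b) - f (v + b))"
    have "2 * N - 3 * e \<le> P ?D"
      using 1 2 g(2)[of ?D] by (simp add: gdiff gadd)
    also have "P ?D \<le> P (?D - ?E) + P ?E"
      using P.triangle[of "?D - ?E" ?E] by (simp only: diff_add_cancel)
    also have "P (?D - ?E) = P ((f (v + x) - f u) + (f (v + x + b) - f (u + b)))"
      by (simp add: algebra_simps)
    also have "\<dots> \<le> P (f (v + x) - f u) + P (f (v + x + b) - f (u + b))"
      by (rule P.triangle)
    also have "\<dots> = 2 * p (s *\<^sub>R b)"
      using S vx by (simp add: iso add x_def)
    finally have "2 * N - 5 * e \<le> P ?E"
      using s by simp
    moreover have "p (u - v) - e \<le> N"
      using p.diff_le[of "u - v" x] s by (simp add: N_def x_def)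
    ultimately show "2 * p (u - v) \<le> P ?E + e'"
      by (simp add: e_def)
  qed
qed

section \<open>Matrix norms\<close>

text \<open>
  Matrices are functions of two indices, so the pointwise vector space structure makes the matrix
  norm a seminorm on a real vector space.
\<close>

instantiation "fun" :: (type, real_vector) real_vector
begin

definition scaleR_fun :: "real \<Rightarrow> ('a \<Rightarrow> 'b) \<Rightarrow> 'a \<Rightarrow> 'b"
  where "scaleR_fun r f = (\<lambda>x. r *\<^sub>R f x)"

instance
  by standard (simp_all add: scaleR_fun_def plus_fun_def algebra_simps)

end

lemma scaleR_fun_apply [simp]: "(r *\<^sub>R f) x = r *\<^sub>R f x"
  by (simp add: scaleR_fun_def)

lemma cinner_scaleR_right: "cinner x (r *\<^sub>R y) = of_real r * cinner x y"
  by (metis cinner_scaleC_right scaleC_of_real)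

text \<open>
  The Cauchy--Schwarz inequality follows from the triangle inequality, by comparing the squares of
  both sides of the latter.
\<close>

lemma Re_cinner_le: "Re (cinner x y) \<le> norm x * norm (y :: 'h::chilbert_space)"
proof -
  have "cinner (x + y) (x + y) = cinner x x + cinner x y + (cinner y x + cinner y y)"
    by (metis cinner_add_right cinner_commute complex_cnj_add)
  moreover have "Re (cinner y x) = Re (cinner x y)"
    by (subst cinner_commute) simp
  ultimately have "(norm (x + y))\<^sup>2 = (norm x)\<^sup>2 + 2 * Re (cinner x y) + (norm y)\<^sup>2"
    by (simp add: cinner_norm_sq complex_eq_iff)
  moreover have "(norm (x + y))\<^sup>2 \<le> (norm x + norm y)\<^sup>2"
    by (simp add: norm_triangle_ineq power_mono)
  ultimately show ?thesis
    by (simp add: power2_sum)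
qed

lemma mat_apply_add: "mat_apply n (x + y) \<xi> = (\<lambda>i. mat_apply n x \<xi> i + mat_apply n y \<xi> i)"
  by (simp add: fun_eq_iff mat_apply_def blinfun.add_left sum.distrib)

lemma mat_apply_scaleR: "mat_apply n (r *\<^sub>R x) \<xi> = (\<lambda>i. r *\<^sub>R mat_apply n x \<xi> i)"
  by (simp add: fun_eq_iff mat_apply_def blinfun.scaleR_left scaleR_sum_right)

lemma sum_norm_nonneg: "0 \<le> sum_norm n \<xi>"
  by (simp add: sum_norm_def)

lemma sum_norm_add_le: "sum_norm n (\<lambda>i. \<xi> i + \<eta> i) \<le> sum_norm n \<xi> + sum_norm n \<eta>"
  unfolding sum_norm_def
  by (rule order.trans[OF L2_set_mono L2_set_triangle_ineq]) (auto intro: norm_triangle_ineq)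

lemma sum_norm_scaleR: "sum_norm n (\<lambda>i. r *\<^sub>R \<xi> i) = \<bar>r\<bar> * sum_norm n \<xi>"
  by (simp add: sum_norm_def L2_set_right_distrib)

lemma sum_norm_mat_apply_le: "sum_norm n \<xi> \<le> 1 \<Longrightarrow> sum_norm n (mat_apply n x \<xi>) \<le> mat_norm n x"
  unfolding mat_norm_def by (rule cSUP_upper[OF _ bdd_above_mat_norm]) simp

lemma sum_norm_zero: "sum_norm n (\<lambda>_. 0) = 0"
  by (simp add: sum_norm_def L2_set_def)

lemma mat_norm_least:
  assumes "\<And>\<xi>. sum_norm n \<xi> \<le> 1 \<Longrightarrow> sum_norm n (mat_apply n x \<xi>) \<le> B"
  shows "mat_norm n x \<le> B"
  unfolding mat_norm_def
proof (rule cSUP_least)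
  have "(\<lambda>_. 0) \<in> {\<xi> :: nat \<Rightarrow> 'a. sum_norm n \<xi> \<le> 1}"
    by (simp add: sum_norm_zero)
  then show "{\<xi> :: nat \<Rightarrow> 'a. sum_norm n \<xi> \<le> 1} \<noteq> {}"
    by blast
qed (use assms in auto)

lemma mat_norm_scaleR_le: "mat_norm n (r *\<^sub>R x) \<le> \<bar>r\<bar> * mat_norm n x"
proof (rule mat_norm_least)
  fix \<xi> :: "nat \<Rightarrow> 'a"
  assume "sum_norm n \<xi> \<le> 1"
  then have "\<bar>r\<bar> * sum_norm n (mat_apply n x \<xi>) \<le> \<bar>r\<bar> * mat_norm n x"
    by (intro mult_left_mono sum_norm_mat_apply_le) auto
  then show "sum_norm n (mat_apply n (r *\<^sub>R x) \<xi>) \<le> \<bar>r\<bar> * mat_norm n x"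
    by (simp add: mat_apply_scaleR sum_norm_scaleR)
qed

lemma seminorm_mat_norm: "seminorm (mat_norm n :: (nat \<Rightarrow> nat \<Rightarrow> 'h::chilbert_space \<Rightarrow>\<^sub>L 'h) \<Rightarrow> real)"
proof
  fix x y :: "nat \<Rightarrow> nat \<Rightarrow> 'h \<Rightarrow>\<^sub>L 'h" and r :: real
  show "mat_norm n (x + y) \<le> mat_norm n x + mat_norm n y"
  proof (rule mat_norm_least)
    fix \<xi> :: "nat \<Rightarrow> 'h"
    assume \<xi>: "sum_norm n \<xi> \<le> 1"
    have "sum_norm n (mat_apply n (x + y) \<xi>)
        \<le> sum_norm n (mat_apply n x \<xi>) + sum_norm n (mat_apply n y \<xi>)"
      using sum_norm_add_le[of n "mat_apply n x \<xi>" "mat_apply n y \<xi>"]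
      by (simp add: mat_apply_add)
    then show "sum_norm n (mat_apply n (x + y) \<xi>) \<le> mat_norm n x + mat_norm n y"
      using sum_norm_mat_apply_le[OF \<xi>, of x] sum_norm_mat_apply_le[OF \<xi>, of y] by linarith
  qed
  show "mat_norm n (r *\<^sub>R x) = \<bar>r\<bar> * mat_norm n x"
  proof (cases "r = 0")
    case True
    have "0 \<le> mat_norm n (0 :: nat \<Rightarrow> nat \<Rightarrow> 'h \<Rightarrow>\<^sub>L 'h)"
      by (rule order.trans[OF sum_norm_nonneg sum_norm_mat_apply_le[of n "\<lambda>_. 0"]])
        (simp add: sum_norm_zero)
    then show ?thesis
      using mat_norm_scaleR_le[of n 0 x] True by simp
  next
    case False
    then have "\<bar>r\<bar> * mat_norm n x \<le> mat_norm n (r *\<^sub>R x)"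
      using mat_norm_scaleR_le[of n "1 / r" "r *\<^sub>R x"] by (simp add: field_simps)
    then show ?thesis
      using mat_norm_scaleR_le[of n r x] by simp
  qed
qed

text \<open>
  A vector \<open>\<xi>\<close> of norm at most \<open>1\<close> almost attains the norm of \<open>w\<close>. With \<open>\<eta>\<close> the normalisation of
  \<open>w \<xi>\<close>, the vector functional \<open>y \<mapsto> Re \<langle>\<eta>, y \<xi>\<rangle>\<close> takes the value \<open>\<parallel>w \<xi>\<parallel>\<close> at \<open>w\<close>.
\<close>

lemma normed_by_functionals_mat_norm:
  "normed_by_functionals (mat_norm n :: (nat \<Rightarrow> nat \<Rightarrow> 'h::chilbert_space \<Rightarrow>\<^sub>L 'h) \<Rightarrow> real)"
proof (intro normed_by_functionals.intro normed_by_functionals_axioms.intro seminorm_mat_norm)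
  fix e :: real and w :: "nat \<Rightarrow> nat \<Rightarrow> 'h \<Rightarrow>\<^sub>L 'h"
  assume "e > 0"
  obtain \<xi> where \<xi>: "sum_norm n \<xi> \<le> 1" "mat_norm n w - e < sum_norm n (mat_apply n w \<xi>)"
  proof (rule ccontr)
    assume "\<not> thesis"
    then have "sum_norm n (mat_apply n w \<xi>) \<le> mat_norm n w - e" if "sum_norm n \<xi> \<le> 1" for \<xi>
      using that \<open>\<And>\<xi>. sum_norm n \<xi> \<le> 1 \<Longrightarrow> mat_norm n w - e < sum_norm n (mat_apply n w \<xi>) \<Longrightarrow> thesis\<close>
      by (meson not_less)
    then have "mat_norm n w \<le> mat_norm n w - e"
      by (rule mat_norm_least)
    then show False
      using \<open>e > 0\<close> by simp
  qed
  \<comment> \<open>if \<open>c = 0\<close> then \<open>\<eta> = 0\<close>, and \<open>g = 0\<close> has the required value \<open>c\<close> at \<open>w\<close>\<close>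
  define c where "c = sum_norm n (mat_apply n w \<xi>)"
  define \<eta> where "\<eta> i = (1 / c) *\<^sub>R mat_apply n w \<xi> i" for i
  define g :: "(nat \<Rightarrow> nat \<Rightarrow> 'h \<Rightarrow>\<^sub>L 'h) \<Rightarrow> real"
    where "g y = (\<Sum>i<n. Re (cinner (\<eta> i) (mat_apply n y \<xi> i)))" for y
  have "c \<ge> 0"
    by (simp add: c_def sum_norm_nonneg)
  have "linear g"
    by (rule linearI)
      (simp_all add: g_def mat_apply_add mat_apply_scaleR cinner_add_right cinner_scaleR_right
        sum.distrib sum_distrib_left)
  moreover have "g y \<le> mat_norm n y" for y
  proof -
    have "g y \<le> (\<Sum>i<n. norm (\<eta> i) * norm (mat_apply n y \<xi> i))"
      unfolding g_def by (intro sum_mono Re_cinner_le)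
    also have "\<dots> \<le> sum_norm n \<eta> * sum_norm n (mat_apply n y \<xi>)"
      unfolding sum_norm_def
      using L2_set_mult_ineq[of "\<lambda>i. norm (\<eta> i)" "\<lambda>i. norm (mat_apply n y \<xi> i)" "{..<n}"] by simp
    also have "\<dots> \<le> 1 * mat_norm n y"
    proof (intro mult_mono sum_norm_mat_apply_le \<xi> sum_norm_nonneg)
      show "sum_norm n \<eta> \<le> 1"
        using \<open>c \<ge> 0\<close> unfolding \<eta>_def sum_norm_scaleR by (simp flip: c_def)
    qed auto
    finally show ?thesis
      by simp
  qed
  moreover have "g w = c"
  proof -
    have "cinner (\<eta> i) (mat_apply n w \<xi> i) = of_real ((1 / c) * (norm (mat_apply n w \<xi> i))\<^sup>2)" for i
    proof -
      have "cinner (\<eta> i) (mat_apply n w \<xi> i) = cnj (cinner (mat_apply n w \<xi> i) (\<eta> i))"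
        by (rule cinner_commute)
      then show ?thesis
        by (simp add: \<eta>_def cinner_scaleR_right cinner_norm_sq)
    qed
    then have "g w = (1 / c) * (\<Sum>i<n. (norm (mat_apply n w \<xi> i))\<^sup>2)"
      by (simp add: g_def sum_divide_distrib)
    also have "(\<Sum>i<n. (norm (mat_apply n w \<xi> i))\<^sup>2) = c\<^sup>2"
      by (simp add: c_def sum_norm_def L2_set_def sum_nonneg)
    finally show ?thesis
      by (simp add: power2_eq_square)
  qed
  ultimately show "\<exists>g. linear g \<and> (\<forall>y. g y \<le> mat_norm n y) \<and> mat_norm n w - e \<le> g w"
    using \<xi>(2) unfolding c_def by (intro exI[of _ g]) auto
qed

lemma mat_norm_le_sum_entries: "mat_norm n x \<le> (\<Sum>i<n. \<Sum>j<n. norm (x i j))"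
proof (rule mat_norm_least)
  fix \<xi> :: "nat \<Rightarrow> 'a"
  assume "sum_norm n \<xi> \<le> 1"
  then have \<xi>: "norm (\<xi> j) \<le> 1" if "j < n" for j
    using member_le_L2_set[of "{..<n}" j "\<lambda>i. norm (\<xi> i)"] that by (simp add: sum_norm_def)
  have "norm (mat_apply n x \<xi> i) \<le> (\<Sum>j<n. norm (x i j))" for i
    unfolding mat_apply_def
  proof (intro order.trans[OF norm_sum] sum_mono)
    fix j assume "j \<in> {..<n}"
    then show "norm (blinfun_apply (x i j) (\<xi> j)) \<le> norm (x i j)"
      using norm_blinfun[of "x i j" "\<xi> j"] \<xi>[of j] mult_left_le[of "norm (\<xi> j)" "norm (x i j)"]
      by simp
  qed
  then have "(\<Sum>i<n. norm (mat_apply n x \<xi> i)) \<le> (\<Sum>i<n. \<Sum>j<n. norm (x i j))"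
    by (intro sum_mono)
  then show "sum_norm n (mat_apply n x \<xi>) \<le> (\<Sum>i<n. \<Sum>j<n. norm (x i j))"
    unfolding sum_norm_def by (intro order.trans[OF L2_set_le_sum]) auto
qed

lemma norm_entry_le_mat_norm:
  assumes "i < n" "j < n"
  shows "norm (x i j) \<le> mat_norm n x"
proof (rule norm_blinfun_bound)
  interpret seminorm "mat_norm n"
    by (rule seminorm_mat_norm)
  show "0 \<le> mat_norm n x"
    by (rule nonneg)
  fix v :: 'a
  show "norm (blinfun_apply (x i j) v) \<le> mat_norm n x * norm v"
  proof (cases "v = 0")
    case False
    define \<xi> where "\<xi> k = (if k = j then v /\<^sub>R norm v else 0)" for k
    have "sum_norm n \<xi> \<le> (\<Sum>k<n. norm (\<xi> k))"
      unfolding sum_norm_def by (rule L2_set_le_sum) auto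
    also have "\<dots> = (\<Sum>k<n. if k = j then 1 else 0)"
      using False by (intro sum.cong) (auto simp: \<xi>_def)
    finally have \<xi>: "sum_norm n \<xi> \<le> 1"
      using assms by simp
    have "mat_apply n x \<xi> i = (\<Sum>k<n. if k = j then blinfun_apply (x i j) (v /\<^sub>R norm v) else 0)"
      unfolding mat_apply_def by (intro sum.cong) (auto simp: \<xi>_def)
    then have "norm (blinfun_apply (x i j) (v /\<^sub>R norm v)) = norm (mat_apply n x \<xi> i)"
      using assms by simp
    also have "\<dots> \<le> sum_norm n (mat_apply n x \<xi>)"
      unfolding sum_norm_def using assms
      by (intro member_le_L2_set[of "{..<n}" i "\<lambda>i. norm (mat_apply n x \<xi> i)"]) auto
    also have "\<dots> \<le> mat_norm n x"
      by (rule sum_norm_mat_apply_le[OF \<xi>])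
    finally show ?thesis
      using False by (simp add: blinfun.scaleR_right divide_simps)
  qed simp
qed

lemma tendsto_mat_norm:
  assumes "\<And>i j. i < n \<Longrightarrow> j < n \<Longrightarrow> (\<lambda>k. x k i j) \<longlonglongrightarrow> y i j"
  shows "(\<lambda>k. mat_norm n (x k)) \<longlonglongrightarrow> mat_norm n y"
proof (rule LIM_zero_cancel, rule Lim_null_comparison)
  interpret seminorm "mat_norm n"
    by (rule seminorm_mat_norm)
  have "norm (mat_norm n (x k) - mat_norm n y) \<le> (\<Sum>i<n. \<Sum>j<n. norm (x k i j - y i j))" for k
    using diff_le[of "x k" y] mat_norm_le_sum_entries[of n "x k - y"] by simp
  then show "\<forall>\<^sub>F k in sequentially.
      norm (mat_norm n (x k) - mat_norm n y) \<le> (\<Sum>i<n. \<Sum>j<n. norm (x k i j - y i j))"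
    by simp
  show "(\<lambda>k. \<Sum>i<n. \<Sum>j<n. norm (x k i j - y i j)) \<longlonglongrightarrow> 0"
    using assms by (intro tendsto_null_sum tendsto_norm_zero LIM_zero) auto
qed

lemma mat_norm_single_entry:
  assumes "n \<ge> 1"
  shows "mat_norm n (\<lambda>i j. if i = 0 \<and> j = 0 then z else 0) = norm z"
proof (rule antisym)
  have "(\<Sum>i<n. \<Sum>j<n. norm (if i = 0 \<and> j = 0 then z else 0))
      = (\<Sum>i<n. \<Sum>j<n. if j = 0 then if i = 0 then norm z else 0 else 0)"
    by (intro sum.cong) auto
  also have "\<dots> = norm z"
    using assms by simp
  finally show "mat_norm n (\<lambda>i j. if i = 0 \<and> j = 0 then z else 0) \<le> norm z"
    using mat_norm_le_sum_entries[of n "\<lambda>i j. if i = 0 \<and> j = 0 then z else 0"] by simp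
  show "norm z \<le> mat_norm n (\<lambda>i j. if i = 0 \<and> j = 0 then z else 0)"
    using norm_entry_le_mat_norm[of 0 n 0 "\<lambda>i j. if i = 0 \<and> j = 0 then z else 0"] assms by simp
qed

lemma subspace_mats: "subspace X \<Longrightarrow> subspace (mats n X)"
  by (auto simp: subspace_def mats_def)

lemma operator_space_subspace:
  assumes "operator_space X"
  shows "subspace X"
proof (rule subspaceI)
  fix r :: real and T
  assume "T \<in> X"
  moreover have "scaleC_op (of_real r) T = r *\<^sub>R T"
    by (rule blinfun_eqI) (simp add: scaleC_op_apply scaleC_of_real blinfun.scaleR_left)
  ultimately show "r *\<^sub>R T \<in> X"
    using assms by (metis operator_space_def)
qed (use assms in \<open>auto simp: operator_space_def\<close>)

section \<open>Isometric maps and their averages\<close>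

locale amplified_isometries =
  fixes n :: nat and X :: "('h::chilbert_space \<Rightarrow>\<^sub>L 'h) set" and Y :: "('k::chilbert_space \<Rightarrow>\<^sub>L 'k) set"
  assumes n: "n \<ge> 1" and X: "subspace X" "closed X" and Y: "subspace Y" "closed Y"
begin

definition isos :: "(('h \<Rightarrow>\<^sub>L 'h) \<Rightarrow> ('k \<Rightarrow>\<^sub>L 'k)) set"
  where "isos = {F. F \<in> X \<rightarrow> Y \<and> amplification_isometric n X F}"

lemma isos_iff:
  "F \<in> isos \<longleftrightarrow> F \<in> X \<rightarrow> Y \<and>
    (\<forall>x\<in>mats n X. \<forall>y\<in>mats n X.
      mat_norm n (amplification F x - amplification F y) = mat_norm n (x - y))"
  by (simp add: isos_def amplification_isometric_def fun_diff_def)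

lemmas X_closed [simp, intro] =
  subspace_add[OF X(1)] subspace_diff[OF X(1)] subspace_scale[OF X(1)] subspace_0[OF X(1)]
  subspace_neg[OF X(1)]

lemma isos_mem: "F \<in> isos \<Longrightarrow> v \<in> X \<Longrightarrow> F v \<in> Y"
  by (auto simp: isos_def)

text \<open>
  Two matrices that agree in all entries but one have images that agree in all entries but that one,
  and their distance is the distance of the two remaining entries.
\<close>

lemma isos_norm:
  assumes "F \<in> isos" "x \<in> X" "y \<in> X"
  shows "norm (F x - F y) = norm (x - y)"
proof -
  define E :: "('h \<Rightarrow>\<^sub>L 'h) \<Rightarrow> nat \<Rightarrow> nat \<Rightarrow> 'h \<Rightarrow>\<^sub>L 'h"
    where "E z = (\<lambda>i j. if i = 0 \<and> j = 0 then z else 0)" for z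
  have "E z \<in> mats n X" if "z \<in> X" for z
    using that by (auto simp: E_def mats_def)
  then have "mat_norm n (amplification F (E x) - amplification F (E y)) = mat_norm n (E x - E y)"
    using assms by (simp add: isos_iff)
  moreover have "amplification F (E x) - amplification F (E y)
      = (\<lambda>i j. if i = 0 \<and> j = 0 then F x - F y else 0)"
    by (auto simp: fun_eq_iff amplification_def E_def)
  moreover have "E x - E y = (\<lambda>i j. if i = 0 \<and> j = 0 then x - y else 0)"
    by (auto simp: fun_eq_iff E_def)
  ultimately show ?thesis
    using n by (simp only: mat_norm_single_entry)
qed

definition mid :: "('h \<Rightarrow>\<^sub>L 'h) \<Rightarrow> (('h \<Rightarrow>\<^sub>L 'h) \<Rightarrow> ('k \<Rightarrow>\<^sub>L 'k)) \<Rightarrow> ('h \<Rightarrow>\<^sub>L 'h) \<Rightarrow> ('k \<Rightarrow>\<^sub>L 'k)"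
  where "mid b F v = (1/2) *\<^sub>R (F v + F (v + b))"

lemma mid_isos:
  assumes F: "F \<in> isos" and b: "b \<in> X"
  shows "mid b F \<in> isos"
  unfolding isos_iff
proof (intro conjI ballI Pi_I)
  fix v assume "v \<in> X"
  then show "mid b F v \<in> Y"
    using F b by (simp add: mid_def subspace_scale[OF Y(1)] subspace_add[OF Y(1)] isos_mem)
next
  fix x y assume x: "x \<in> mats n X" and y: "y \<in> mats n X"
  interpret seminorm "mat_norm n :: (nat \<Rightarrow> nat \<Rightarrow> 'k \<Rightarrow>\<^sub>L 'k) \<Rightarrow> real"
    by (rule seminorm_mat_norm)
  define B where "B = (\<lambda>(i::nat) (j::nat). b)"
  let ?A = "amplification F"
  have "B \<in> mats n X"
    using b by (simp add: B_def mats_def)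
  then have "mat_norm n ((?A x - ?A y) + (?A (x + B) - ?A (y + B))) = 2 * mat_norm n (x - y)"
    using x y F
    by (intro isometry_add_translates[where S = "mats n X" and p = "mat_norm n"
          and P = "mat_norm n" and f = ?A] seminorm_mat_norm
        normed_by_functionals_mat_norm subspace_mats X) (simp_all add: isos_iff)
  moreover have "amplification (mid b F) x - amplification (mid b F) y
      = (1/2) *\<^sub>R ((?A x - ?A y) + (?A (x + B) - ?A (y + B)))"
    by (simp add: fun_eq_iff amplification_def mid_def B_def algebra_simps)
  ultimately show "mat_norm n (amplification (mid b F) x - amplification (mid b F) y) = mat_norm n (x - y)"
    by (simp only: scale)
qed

lemma pointwise_limit_isos:
  assumes F: "\<And>k. F k \<in> isos" and lim: "\<And>v. v \<in> X \<Longrightarrow> (\<lambda>k. F k v) \<longlonglongrightarrow> G v"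
  shows "G \<in> isos"
  unfolding isos_iff
proof (intro conjI ballI Pi_I)
  fix v assume "v \<in> X"
  then show "G v \<in> Y"
    by (intro closed_sequentially[OF Y(2) _ lim] isos_mem[OF F])
next
  fix x y assume x: "x \<in> mats n X" and y: "y \<in> mats n X"
  have "(\<lambda>k. mat_norm n (amplification (F k) x - amplification (F k) y))
      \<longlonglongrightarrow> mat_norm n (amplification G x - amplification G y)"
    using x y by (intro tendsto_mat_norm) (auto simp: amplification_def mats_def intro!: tendsto_diff lim)
  moreover have "mat_norm n (amplification (F k) x - amplification (F k) y) = mat_norm n (x - y)" for k
    using F x y by (simp add: isos_iff)
  ultimately show "mat_norm n (amplification G x - amplification G y) = mat_norm n (x - y)"
    by (simp add: LIMSEQ_const_iff)
qed

text \<open>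
  Difference quotient of \<open>F\<close> at \<open>v\<close> in direction \<open>x\<close> with step \<open>h\<close>. Only positive steps are considered
  below: a step backwards from \<open>v\<close> is a step forwards from another base point, and the base points
  vary as well.
\<close>

definition dq :: "(('h \<Rightarrow>\<^sub>L 'h) \<Rightarrow> ('k \<Rightarrow>\<^sub>L 'k)) \<Rightarrow> ('h \<Rightarrow>\<^sub>L 'h) \<Rightarrow> ('h \<Rightarrow>\<^sub>L 'h) \<Rightarrow> real \<Rightarrow> 'k \<Rightarrow>\<^sub>L 'k"
  where "dq F x v h = (1 / h) *\<^sub>R (F (v + h *\<^sub>R x) - F v)"

lemma dq_isos:
  assumes F: "F \<in> isos" and "h > 0"
  shows "(\<lambda>x. dq F x 0 h) \<in> isos"
  unfolding isos_iff
proof (intro conjI ballI Pi_I)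
  fix v assume "v \<in> X"
  then show "dq F v 0 h \<in> Y"
    using F by (simp add: dq_def subspace_scale[OF Y(1)] subspace_diff[OF Y(1)] isos_mem)
next
  fix x y assume x: "x \<in> mats n X" and y: "y \<in> mats n X"
  interpret K: seminorm "mat_norm n :: (nat \<Rightarrow> nat \<Rightarrow> 'k \<Rightarrow>\<^sub>L 'k) \<Rightarrow> real"
    by (rule seminorm_mat_norm)
  interpret H: seminorm "mat_norm n :: (nat \<Rightarrow> nat \<Rightarrow> 'h \<Rightarrow>\<^sub>L 'h) \<Rightarrow> real"
    by (rule seminorm_mat_norm)
  let ?D = "amplification (\<lambda>x. dq F x 0 h)"
  have "?D x - ?D y = (1 / h) *\<^sub>R (amplification F (h *\<^sub>R x) - amplification F (h *\<^sub>R y))"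
    by (simp add: fun_eq_iff amplification_def dq_def algebra_simps)
  then have "mat_norm n (?D x - ?D y)
      = (1 / h) * mat_norm n (amplification F (h *\<^sub>R x) - amplification F (h *\<^sub>R y))"
    using \<open>h > 0\<close> by (simp only: K.scale) simp
  also have "\<dots> = (1 / h) * mat_norm n (h *\<^sub>R (x - y))"
    using F x y subspace_scale[OF subspace_mats[OF X(1)]] by (simp add: isos_iff scaleR_right_diff_distrib)
  also have "\<dots> = mat_norm n (x - y)"
    using \<open>h > 0\<close> by (simp add: H.scale)
  finally show "mat_norm n (?D x - ?D y) = mat_norm n (x - y)" .
qed

definition avg :: "('h \<Rightarrow>\<^sub>L 'h) \<Rightarrow> (('h \<Rightarrow>\<^sub>L 'h) \<Rightarrow> ('k \<Rightarrow>\<^sub>L 'k)) \<Rightarrow> ('h \<Rightarrow>\<^sub>L 'h) \<Rightarrow> ('k \<Rightarrow>\<^sub>L 'k)"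
  where "avg a F v = integral {0..1} (\<lambda>t. F (v + t *\<^sub>R a))"

lemma isos_continuous_on_line:
  assumes "F \<in> isos" "v \<in> X" "a \<in> X"
  shows "continuous_on S (\<lambda>t. F (v + t *\<^sub>R a))"
proof (rule lipschitz_on_continuous_on, rule lipschitz_onI)
  fix s t
  show "dist (F (v + s *\<^sub>R a)) (F (v + t *\<^sub>R a)) \<le> norm a * dist s t"
    using assms isos_norm[of F "v + s *\<^sub>R a" "v + t *\<^sub>R a"]
    by (simp add: dist_norm mult.commute flip: scaleR_left_diff_distrib)
qed simp

lemma isos_integrable_on_line:
  assumes "F \<in> isos" "v \<in> X" "a \<in> X"
  shows "(\<lambda>t. F (v + t *\<^sub>R a)) integrable_on {c..d}"
  using isos_continuous_on_line[OF assms] by (rule integrable_continuous_interval)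

text \<open>
  The average over a segment is the mean of the averages over its two halves, which are translates
  of each other by \<open>a / 2\<close>. So averaging along \<open>a\<close> amounts to a midpoint of translates followed by
  averaging along \<open>a / 2\<close>.
\<close>

lemma avg_halving:
  assumes F: "F \<in> isos" and v: "v \<in> X" and a: "a \<in> X"
  shows "avg a F v = avg ((1/2) *\<^sub>R a) (mid ((1/2) *\<^sub>R a) F) v"
proof -
  define \<phi> where "\<phi> = (\<lambda>t. F (v + t *\<^sub>R a))"
  have int: "\<phi> integrable_on {c..d}" for c d
    unfolding \<phi>_def using isos_integrable_on_line[OF F v a] .
  have I: "(\<phi> has_integral integral {c..d} \<phi>) (cbox c d)" for c d
    using int by (simp add: has_integral_integral[symmetric])
  have "((\<lambda>t. \<phi> ((1/2) *\<^sub>R t + 0)) has_integral 2 *\<^sub>R integral {0..1/2} \<phi>) {0..1}"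
    using has_integral_affinity'[OF I[of 0 "1/2"], of "1/2" 0] by simp
  moreover have "((\<lambda>t. \<phi> ((1/2) *\<^sub>R t + 1/2)) has_integral 2 *\<^sub>R integral {1/2..1} \<phi>) {0..1}"
    using has_integral_affinity'[OF I[of "1/2" 1], of "1/2" "1/2"] by simp
  ultimately have "((\<lambda>t. (1/2) *\<^sub>R (\<phi> ((1/2) *\<^sub>R t + 0) + \<phi> ((1/2) *\<^sub>R t + 1/2))) has_integral
      (1/2) *\<^sub>R (2 *\<^sub>R integral {0..1/2} \<phi> + 2 *\<^sub>R integral {1/2..1} \<phi>)) {0..1}"
    by (intro has_integral_cmul has_integral_add)
  also have "(1/2) *\<^sub>R (2 *\<^sub>R integral {0..1/2} \<phi> + 2 *\<^sub>R integral {1/2..1} \<phi>)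
      = integral {0..1/2} \<phi> + integral {1/2..1} \<phi>"
    by (simp add: scaleR_add_right)
  also have "\<dots> = avg a F v"
    using Henstock_Kurzweil_Integration.integral_combine[OF _ _ int, of 0 "1/2" 1] by (simp add: avg_def \<phi>_def)
  also have "(\<lambda>t. (1/2) *\<^sub>R (\<phi> ((1/2) *\<^sub>R t + 0) + \<phi> ((1/2) *\<^sub>R t + 1/2)))
      = (\<lambda>t. mid ((1/2) *\<^sub>R a) F (v + t *\<^sub>R ((1/2) *\<^sub>R a)))"
    by (simp add: \<phi>_def mid_def fun_eq_iff algebra_simps)
  finally show ?thesis
    unfolding avg_def[of "(1/2) *\<^sub>R a"] by (rule integral_unique[symmetric])
qed

lemma avg_close:
  assumes F: "F \<in> isos" and v: "v \<in> X" and a: "a \<in> X"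
  shows "norm (avg a F v - F v) \<le> norm a"
proof -
  have "avg a F v - F v = integral {0..1} (\<lambda>t. F (v + t *\<^sub>R a) - F v)"
    using isos_integrable_on_line[OF F v a] by (simp add: avg_def Henstock_Kurzweil_Integration.integral_diff integrable_const_ivl)
  also have "norm \<dots> \<le> norm a * (1 - 0)"
  proof (rule integral_bound)
    show "continuous_on {0..1} (\<lambda>t. F (v + t *\<^sub>R a) - F v)"
      by (intro continuous_intros isos_continuous_on_line assms)
    fix t :: real assume "t \<in> {0..1}"
    then show "norm (F (v + t *\<^sub>R a) - F v) \<le> norm a"
      using v a by (simp add: isos_norm[OF F] mult_left_le_one_le)
  qed simp
  finally show ?thesis
    by simp
qed

text \<open>
  After \<open>m\<close> halvings the average along \<open>a\<close> is the average along \<open>2\<^sup>-\<^sup>m a\<close> of a map \<open>H\<close> obtained by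
  \<open>m\<close> midpoints of translates. It differs from \<open>H\<close> by at most \<open>2\<^sup>-\<^sup>m \<parallel>a\<parallel>\<close>, hence is a pointwise limit
  of such maps.
\<close>

lemma avg_isos:
  assumes F: "F \<in> isos" and a: "a \<in> X"
  shows "avg a F \<in> isos"
proof -
  have "\<exists>H\<in>isos. \<forall>v\<in>X. avg a F v = avg ((1/2)^m *\<^sub>R a) H v" for m
  proof (induction m)
    case 0
    then show ?case
      using F by auto
  next
    case (Suc m)
    then obtain H where H: "H \<in> isos" "\<And>v. v \<in> X \<Longrightarrow> avg a F v = avg ((1/2)^m *\<^sub>R a) H v"
      by blast
    have "avg a F v = avg ((1/2)^Suc m *\<^sub>R a) (mid ((1/2)^Suc m *\<^sub>R a) H) v" if "v \<in> X" for v
      using avg_halving[OF H(1) that, of "(1/2)^m *\<^sub>R a"] H(2)[OF that] a by simp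
    then show ?case
      using mid_isos[OF H(1), of "(1/2)^Suc m *\<^sub>R a"] a by blast
  qed
  then obtain H where H: "\<And>m. H m \<in> isos" "\<And>m v. v \<in> X \<Longrightarrow> avg a F v = avg ((1/2)^m *\<^sub>R a) (H m) v"
    by metis
  show ?thesis
  proof (rule pointwise_limit_isos)
    fix v assume v: "v \<in> X"
    have le: "norm (H m v - avg a F v) \<le> (1/2)^m * norm a" for m
    proof -
      have "norm (avg ((1/2)^m *\<^sub>R a) (H m) v - H m v) \<le> (1/2)^m * norm a"
        using avg_close[OF H(1) v, of "(1/2)^m *\<^sub>R a" m] a by simp
      then show ?thesis
        by (simp only: H(2)[OF v, of m] norm_minus_commute)
    qed
    have "(\<lambda>m. (1/2)^m * norm a) \<longlonglongrightarrow> 0"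
      by (intro tendsto_mult_left_zero LIMSEQ_power_zero) simp
    then have "(\<lambda>m. H m v - avg a F v) \<longlonglongrightarrow> 0"
      by (rule Lim_null_comparison[OF always_eventually[OF allI[OF le]]])
    then show "(\<lambda>m. H m v) \<longlonglongrightarrow> avg a F v"
      by (rule LIM_zero_cancel)
  qed (rule H)
qed

text \<open>
  Moving the base point by \<open>h a\<close> shifts the segment of integration by \<open>h\<close>, so the average gains the
  integral over \<open>[1, 1 + h]\<close> and loses the one over \<open>[0, h]\<close>. Divided by \<open>h\<close>, these are close to
  \<open>F (v + a)\<close> and \<open>F v\<close>.
\<close>

lemma dq_avg_near_increment:
  assumes F: "F \<in> isos" and v: "v \<in> X" and a: "a \<in> X" and h: "h > 0"
  shows "norm (dq (avg a F) a v h - (F (v + a) - F v)) \<le> 2 * norm a * h"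
proof -
  define \<phi> where "\<phi> = (\<lambda>t. F (v + t *\<^sub>R a))"
  have int: "\<phi> integrable_on {c..d}" for c d
    unfolding \<phi>_def using isos_integrable_on_line[OF F v a] .
  have cont: "continuous_on S \<phi>" for S
    unfolding \<phi>_def using isos_continuous_on_line[OF F v a] .
  have shift: "\<phi> \<circ> (+) 1 = (\<lambda>t. F ((v + a) + t *\<^sub>R a))"
    by (simp add: fun_eq_iff \<phi>_def scaleR_left_distrib add.assoc)
  have cont1: "continuous_on S (\<phi> \<circ> (+) 1)" for S
    unfolding shift using v a by (intro isos_continuous_on_line F X_closed)
  have int1: "(\<phi> \<circ> (+) 1) integrable_on {c..d}" for c d
    by (rule integrable_continuous_interval[OF cont1])
  have \<phi>_lip: "norm (\<phi> s - \<phi> t) = \<bar>s - t\<bar> * norm a" for s t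
    using isos_norm[OF F, of "v + s *\<^sub>R a" "v + t *\<^sub>R a"] v a
    by (simp add: \<phi>_def flip: scaleR_left_diff_distrib)
  have "avg a F (v + h *\<^sub>R a) = integral {0..1} (\<phi> \<circ> (+) h)"
    by (simp add: avg_def \<phi>_def o_def scaleR_left_distrib add.assoc)
  also have "\<dots> = integral {h..1 + h} \<phi>"
    using integral_shift_Icc_real[of 0 1 \<phi> h] by simp
  also have "\<dots> = integral {0..1 + h} \<phi> - integral {0..h} \<phi>"
    using Henstock_Kurzweil_Integration.integral_combine[OF _ _ int, of 0 h "1 + h"] h by (simp add: algebra_simps)
  also have "integral {0..1 + h} \<phi> = avg a F v + integral {1..1 + h} \<phi>"
    using Henstock_Kurzweil_Integration.integral_combine[OF _ _ int, of 0 1 "1 + h"] h by (simp add: avg_def \<phi>_def)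
  also have "integral {1..1 + h} \<phi> = integral {0..h} (\<phi> \<circ> (+) 1)"
    using integral_shift_Icc_real[of 0 h \<phi> 1] by (simp add: add.commute)
  finally have "avg a F (v + h *\<^sub>R a) - avg a F v - h *\<^sub>R (\<phi> 1 - \<phi> 0)
      = integral {0..h} (\<phi> \<circ> (+) 1) - integral {0..h} \<phi> - integral {0..h} (\<lambda>t. \<phi> 1 - \<phi> 0)"
    using h by simp
  also have "\<dots> = integral {0..h} (\<lambda>t. (\<phi> \<circ> (+) 1) t - \<phi> t - (\<phi> 1 - \<phi> 0))"
    by (simp only: Henstock_Kurzweil_Integration.integral_diff[OF int1 int]
        Henstock_Kurzweil_Integration.integral_diff[OF integrable_diff[OF int1 int] integrable_const_ivl])
  also have "norm \<dots> \<le> 2 * norm a * h * (h - 0)"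
  proof (rule integral_bound)
    show "continuous_on {0..h} (\<lambda>t. (\<phi> \<circ> (+) 1) t - \<phi> t - (\<phi> 1 - \<phi> 0))"
      by (intro continuous_intros cont cont1)
    fix t assume t: "t \<in> {0..h}"
    have "norm ((\<phi> \<circ> (+) 1) t - \<phi> t - (\<phi> 1 - \<phi> 0)) = norm ((\<phi> (1 + t) - \<phi> 1) - (\<phi> t - \<phi> 0))"
      by (simp add: algebra_simps)
    also have "\<dots> \<le> 2 * (t * norm a)"
      using norm_triangle_ineq4[of "\<phi> (1 + t) - \<phi> 1" "\<phi> t - \<phi> 0"] \<phi>_lip[of "1 + t" 1] \<phi>_lip[of t 0] t
      by simp
    also have "\<dots> \<le> 2 * norm a * h"
      using mult_right_mono[of t h "norm a"] t by (simp add: algebra_simps)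
    finally show "norm ((\<phi> \<circ> (+) 1) t - \<phi> t - (\<phi> 1 - \<phi> 0)) \<le> 2 * norm a * h" .
  qed (use h in auto)
  finally have "norm (avg a F (v + h *\<^sub>R a) - avg a F v - h *\<^sub>R (\<phi> 1 - \<phi> 0)) / h \<le> 2 * norm a * h"
    using h by (simp add: field_simps)
  moreover have "dq (avg a F) a v h - (\<phi> 1 - \<phi> 0)
      = (1 / h) *\<^sub>R (avg a F (v + h *\<^sub>R a) - avg a F v - h *\<^sub>R (\<phi> 1 - \<phi> 0))"
    using h by (simp add: dq_def scaleR_right_diff_distrib)
  ultimately show ?thesis
    using h by (simp add: \<phi>_def)
qed

text \<open>
  A Cauchy form of differentiability along \<open>a\<close>, with derivative depending on the base point in a
  Lipschitz way. As the derivative is not named, the condition passes directly through averages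
  and pointwise limits.
\<close>

definition lipschitz_dq :: "(('h \<Rightarrow>\<^sub>L 'h) \<Rightarrow> ('k \<Rightarrow>\<^sub>L 'k)) \<Rightarrow> ('h \<Rightarrow>\<^sub>L 'h) \<Rightarrow> real \<Rightarrow> bool"
  where "lipschitz_dq F a K \<longleftrightarrow> (\<forall>v\<in>X. \<forall>w\<in>X. \<forall>h>0. \<forall>k>0.
    norm (dq F a v h - dq F a w k) \<le> K * (h + k + norm (v - w)))"

lemma lipschitz_dq_avg_same:
  assumes F: "F \<in> isos" and a: "a \<in> X"
  shows "lipschitz_dq (avg a F) a (2 * norm a + 2)"
  unfolding lipschitz_dq_def
proof (intro ballI allI impI)
  fix v w and h k :: real
  assume v: "v \<in> X" and w: "w \<in> X" and "0 < h" "0 < k"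
  let ?p = "dq (avg a F) a v h" and ?q = "dq (avg a F) a w k"
  let ?P = "F (v + a) - F v" and ?Q = "F (w + a) - F w"
  have "?p - ?q = (?p - ?P) - (?q - ?Q) + ((F (v + a) - F (w + a)) - (F v - F w))"
    by simp
  then have "norm (?p - ?q) \<le> norm (?p - ?P) + norm (?q - ?Q)
      + (norm (F (v + a) - F (w + a)) + norm (F v - F w))"
    by (smt (verit) norm_triangle_ineq norm_triangle_ineq4)
  also have "\<dots> \<le> 2 * norm a * h + 2 * norm a * k + 2 * norm (v - w)"
    using dq_avg_near_increment[OF F v a \<open>0 < h\<close>] dq_avg_near_increment[OF F w a \<open>0 < k\<close>] v w a
    by (simp add: isos_norm[OF F])
  also have "\<dots> \<le> (2 * norm a + 2) * (h + k + norm (v - w))"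
    using \<open>0 < h\<close> \<open>0 < k\<close> by (simp add: algebra_simps)
  finally show "norm (?p - ?q) \<le> (2 * norm a + 2) * (h + k + norm (v - w))" .
qed

lemma lipschitz_dq_avg:
  assumes F: "F \<in> isos" and a: "a \<in> X" and b: "b \<in> X" and dq: "lipschitz_dq F a K"
  shows "lipschitz_dq (avg b F) a K"
  unfolding lipschitz_dq_def
proof (intro ballI allI impI)
  fix v w and h k :: real
  assume v: "v \<in> X" and w: "w \<in> X" and "0 < h" "0 < k"
  have line: "(\<lambda>t. dq F a (u + t *\<^sub>R b) l)
      = (\<lambda>t. (1 / l) *\<^sub>R (F ((u + l *\<^sub>R a) + t *\<^sub>R b) - F (u + t *\<^sub>R b)))" for u l
    by (simp add: dq_def add_ac)
  have cont: "continuous_on {0..1} (\<lambda>t. dq F a (u + t *\<^sub>R b) l)" if "u \<in> X" for u l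
    unfolding line using that a b
    by (intro continuous_on_scaleR continuous_on_const continuous_on_diff isos_continuous_on_line F X_closed)
  have dq_avg: "dq (avg b F) a u l = integral {0..1} (\<lambda>t. dq F a (u + t *\<^sub>R b) l)" if "u \<in> X" for u l
  proof -
    have "(\<lambda>t. F ((u + l *\<^sub>R a) + t *\<^sub>R b)) integrable_on {0..1}" "(\<lambda>t. F (u + t *\<^sub>R b)) integrable_on {0..1}"
      using that a b by (intro isos_integrable_on_line F X_closed; simp)+
    then show ?thesis
      unfolding line by (simp only: integral_cmul Henstock_Kurzweil_Integration.integral_diff dq_def avg_def)
  qed
  have "dq (avg b F) a v h - dq (avg b F) a w k
      = integral {0..1} (\<lambda>t. dq F a (v + t *\<^sub>R b) h - dq F a (w + t *\<^sub>R b) k)"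
    unfolding dq_avg[OF v] dq_avg[OF w]
    by (rule Henstock_Kurzweil_Integration.integral_diff[symmetric]; rule integrable_continuous_interval)
      (rule cont[OF v], rule cont[OF w])
  also have "norm \<dots> \<le> (K * (h + k + norm (v - w))) * (1 - 0)"
  proof (rule integral_bound)
    show "continuous_on {0..1} (\<lambda>t. dq F a (v + t *\<^sub>R b) h - dq F a (w + t *\<^sub>R b) k)"
      using v w by (intro continuous_on_diff cont)
    fix t :: real
    have "v + t *\<^sub>R b \<in> X" "w + t *\<^sub>R b \<in> X"
      using v w b by auto
    then have "norm (dq F a (v + t *\<^sub>R b) h - dq F a (w + t *\<^sub>R b) k)
        \<le> K * (h + k + norm ((v + t *\<^sub>R b) - (w + t *\<^sub>R b)))"
      using dq \<open>0 < h\<close> \<open>0 < k\<close> unfolding lipschitz_dq_def by blast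
    then show "norm (dq F a (v + t *\<^sub>R b) h - dq F a (w + t *\<^sub>R b) k) \<le> K * (h + k + norm (v - w))"
      by simp
  qed simp
  finally show "norm (dq (avg b F) a v h - dq (avg b F) a w k) \<le> K * (h + k + norm (v - w))"
    by simp
qed

lemma lipschitz_dq_limit:
  assumes F: "\<forall>\<^sub>F m in sequentially. lipschitz_dq (F m) a K" and a: "a \<in> X"
    and lim: "\<And>v. v \<in> X \<Longrightarrow> (\<lambda>m. F m v) \<longlonglongrightarrow> G v"
  shows "lipschitz_dq G a K"
  unfolding lipschitz_dq_def
proof (intro ballI allI impI)
  fix v w and h k :: real
  assume v: "v \<in> X" and w: "w \<in> X" and "0 < h" "0 < k"
  show "norm (dq G a v h - dq G a w k) \<le> K * (h + k + norm (v - w))"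
  proof (rule tendsto_upperbound)
    show "(\<lambda>m. norm (dq (F m) a v h - dq (F m) a w k)) \<longlonglongrightarrow> norm (dq G a v h - dq G a w k)"
      unfolding dq_def using v w a by (intro tendsto_intros lim) auto
    show "\<forall>\<^sub>F m in sequentially. norm (dq (F m) a v h - dq (F m) a w k) \<le> K * (h + k + norm (v - w))"
      using F by eventually_elim (use v w \<open>0 < h\<close> \<open>0 < k\<close> in \<open>auto simp: lipschitz_dq_def\<close>)
  qed simp
qed

section \<open>Differentiating at the origin\<close>

text \<open>
  Averaging along \<open>a k\<close> creates differentiability in this direction, and all later averages keep
  it with the same constant. Each step moves the map by at most the norm of \<open>a k\<close>, so the
  process converges.
\<close>

lemma ex_isos_lipschitz_dq:
  assumes F: "F \<in> isos" and a: "\<And>k. a k \<in> X" "\<And>k. norm (a k) \<le> (1/2)^k"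
  obtains G where "G \<in> isos" "\<And>k. \<exists>K. lipschitz_dq G (a k) K"
proof -
  define S where "S = rec_nat F (\<lambda>k. avg (a k))"
  have S_Suc: "S (Suc k) = avg (a k) (S k)" for k
    by (simp add: S_def)
  have S: "S k \<in> isos" for k
  proof (induction k)
    case 0
    then show ?case
      using F by (simp add: S_def)
  next
    case (Suc k)
    then show ?case
      unfolding S_Suc using a by (intro avg_isos)
  qed
  define G where "G v = F v + (\<Sum>k. S (Suc k) v - S k v)" for v
  have lim: "(\<lambda>m. S m v) \<longlonglongrightarrow> G v" if "v \<in> X" for v
  proof -
    have step: "norm (S (Suc k) v - S k v) \<le> (1/2)^k" for k
      using avg_close[OF S that a(1), of k k] a(2)[of k] by (simp add: S_Suc)
    have "summable (\<lambda>k. (1/2 :: real)^k)"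
      by (rule summable_geometric) simp
    then have "summable (\<lambda>k. S (Suc k) v - S k v)"
      by (rule summable_comparison_test'[where N = 0]) (rule step)
    then have "(\<lambda>m. S 0 v + (\<Sum>k<m. S (Suc k) v - S k v)) \<longlonglongrightarrow> S 0 v + (\<Sum>k. S (Suc k) v - S k v)"
      by (intro tendsto_add tendsto_const summable_LIMSEQ)
    then show ?thesis
      by (simp add: sum_lessThan_telescope[where f = "\<lambda>k. S k v"] G_def) (simp add: S_def)
  qed
  have "lipschitz_dq G (a k) (2 * norm (a k) + 2)" for k
  proof (rule lipschitz_dq_limit[OF _ a(1) lim])
    have "lipschitz_dq (S m) (a k) (2 * norm (a k) + 2)" if "Suc k \<le> m" for m
      using that
    proof (induction m rule: dec_induct)
      case base
      show ?case
        unfolding S_Suc by (rule lipschitz_dq_avg_same[OF S a(1)])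
    next
      case (step m)
      show ?case
        unfolding S_Suc by (rule lipschitz_dq_avg[OF S a(1) a(1) step.IH])
    qed
    then show "\<forall>\<^sub>F m in sequentially. lipschitz_dq (S m) (a k) (2 * norm (a k) + 2)"
      by (auto simp: eventually_sequentially)
  qed auto
  moreover have "G \<in> isos"
    by (rule pointwise_limit_isos[OF S lim])
  ultimately show thesis
    using that by blast
qed

text \<open>
  The base point \<open>v\<close> of the difference quotient may vary near the origin. This is what makes the
  derivative additive in the direction, and what makes positive steps suffice for negative
  multiples of a direction.
\<close>

definition strict_derivative ::
    "(('h \<Rightarrow>\<^sub>L 'h) \<Rightarrow> ('k \<Rightarrow>\<^sub>L 'k)) \<Rightarrow> ('h \<Rightarrow>\<^sub>L 'h) \<Rightarrow> ('k \<Rightarrow>\<^sub>L 'k) \<Rightarrow> bool"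
  where "strict_derivative G x y \<longleftrightarrow> (\<forall>e>0. \<exists>d>0. \<forall>v\<in>X. \<forall>h.
    norm v < d \<longrightarrow> 0 < h \<longrightarrow> h < d \<longrightarrow> norm (dq G x v h - y) \<le> e)"

lemma strict_derivativeE:
  assumes "strict_derivative G x y" "e > 0"
  obtains d where "d > 0"
    "\<And>v h. v \<in> X \<Longrightarrow> norm v < d \<Longrightarrow> 0 < h \<Longrightarrow> h < d \<Longrightarrow> norm (dq G x v h - y) \<le> e"
  using assms unfolding strict_derivative_def by meson

lemma strict_derivativeI:
  assumes "\<And>e. e > 0 \<Longrightarrow> \<exists>d>0. \<forall>v\<in>X. \<forall>h. norm v < d \<longrightarrow> 0 < h \<longrightarrow> h < d \<longrightarrow> norm (dq G x v h - y) \<le> e"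
  shows "strict_derivative G x y"
  using assms unfolding strict_derivative_def by blast

lemma strict_derivative_imp_limit:
  assumes "strict_derivative G x y"
  shows "(\<lambda>m. dq G x 0 (inverse (real (Suc m)))) \<longlonglongrightarrow> y"
proof (rule metric_LIMSEQ_I)
  fix r :: real assume "r > 0"
  then obtain d where "d > 0" and
    d: "\<And>v h. v \<in> X \<Longrightarrow> norm v < d \<Longrightarrow> 0 < h \<Longrightarrow> h < d \<Longrightarrow> norm (dq G x v h - y) \<le> r / 2"
    using strict_derivativeE[OF assms, of "r / 2"] by auto
  have "\<forall>\<^sub>F m in sequentially. inverse (real (Suc m)) < d"
    using LIMSEQ_inverse_real_of_nat \<open>d > 0\<close> by (rule order_tendstoD)
  then have "\<forall>\<^sub>F m in sequentially. dist (dq G x 0 (inverse (real (Suc m)))) y < r"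
  proof eventually_elim
    case (elim m)
    then show ?case
      using d[of 0 "inverse (real (Suc m))"] \<open>d > 0\<close> \<open>r > 0\<close> by (simp add: dist_norm)
  qed
  then show "\<exists>M. \<forall>m\<ge>M. dist (dq G x 0 (inverse (real (Suc m)))) y < r"
    by (simp add: eventually_sequentially)
qed

lemma strict_derivative_unique:
  "strict_derivative G x y \<Longrightarrow> strict_derivative G x z \<Longrightarrow> y = z"
  by (rule LIMSEQ_unique[OF strict_derivative_imp_limit strict_derivative_imp_limit])

text \<open>
  Completeness: the difference quotients at the origin with steps \<open>1 / (m + 1)\<close> form a Cauchy
  sequence.
\<close>

lemma ex_strict_derivative:
  assumes dq: "lipschitz_dq G a K"
  shows "\<exists>y. strict_derivative G a y"
proof -
  define q where "q m = dq G a 0 (inverse (real (Suc m)))" for m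
  have K: "norm (dq G a v h - dq G a w k) \<le> K * (h + k + norm (v - w))"
    if "v \<in> X" "w \<in> X" "0 < h" "0 < k" for v w h k
    using dq that unfolding lipschitz_dq_def by blast
  have K0: "0 \<le> K"
    using K[of 0 0 1 1] by simp
  have "Cauchy q"
  proof (rule CauchyI)
    fix e :: real assume "e > 0"
    have "(\<lambda>m. K * (2 * inverse (real (Suc m)))) \<longlonglongrightarrow> 0"
      by (intro tendsto_mult_right_zero LIMSEQ_inverse_real_of_nat)
    then have "\<forall>\<^sub>F m in sequentially. K * (2 * inverse (real (Suc m))) < e"
      using \<open>e > 0\<close> by (rule order_tendstoD)
    then obtain M where M: "K * (2 * inverse (real (Suc M))) < e"
      by (auto simp: eventually_sequentially)
    have "norm (q m - q l) < e" if "m \<ge> M" "l \<ge> M" for m l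
    proof -
      have "inverse (real (Suc m)) \<le> inverse (real (Suc M))" "inverse (real (Suc l)) \<le> inverse (real (Suc M))"
        using that by (auto intro!: le_imp_inverse_le)
      then have "K * (inverse (real (Suc m)) + inverse (real (Suc l)) + norm (0 - 0 :: 'h \<Rightarrow>\<^sub>L 'h))
          \<le> K * (2 * inverse (real (Suc M)))"
        using K0 by (intro mult_left_mono; (simp only: diff_self norm_zero)?; linarith)
      then have "norm (q m - q l) \<le> K * (2 * inverse (real (Suc M)))"
        unfolding q_def by (intro order.trans[OF K]) auto
      then show ?thesis
        using M by simp
    qed
    then show "\<exists>M. \<forall>m\<ge>M. \<forall>l\<ge>M. norm (q m - q l) < e"
      by blast
  qed
  then obtain y where y: "q \<longlonglongrightarrow> y"
    using Cauchy_convergent convergent_def by blast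
  have near: "norm (dq G a v h - y) \<le> K * (h + norm v)" if "v \<in> X" "0 < h" for v h
  proof (rule tendsto_le)
    show "(\<lambda>m. norm (dq G a v h - q m)) \<longlonglongrightarrow> norm (dq G a v h - y)"
      by (intro tendsto_intros y)
    have "(\<lambda>m. K * (h + inverse (real (Suc m)) + norm v)) \<longlonglongrightarrow> K * (h + 0 + norm v)"
      by (intro tendsto_intros LIMSEQ_inverse_real_of_nat)
    then show "(\<lambda>m. K * (h + inverse (real (Suc m)) + norm v)) \<longlonglongrightarrow> K * (h + norm v)"
      by simp
    show "\<forall>\<^sub>F m in sequentially. norm (dq G a v h - q m) \<le> K * (h + inverse (real (Suc m)) + norm v)"
      unfolding q_def using K[of v 0 h] that by (intro always_eventually) simp
  qed simp
  have "strict_derivative G a y"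
  proof (rule strict_derivativeI)
    fix e :: real assume "e > 0"
    define d where "d = e / (2 * K + 1)"
    have d: "d > 0" "(2 * K + 1) * d = e"
      using \<open>e > 0\<close> K0 by (auto simp: d_def add_nonneg_pos)
    have "norm (dq G a v h - y) \<le> e" if "v \<in> X" "norm v < d" "0 < h" "h < d" for v h
    proof -
      have "norm (dq G a v h - y) \<le> K * (d + d)"
        using near[OF that(1,3)] mult_left_mono[OF add_mono, of h d "norm v" d K] that K0 by linarith
      also have "\<dots> \<le> e"
        unfolding d(2)[symmetric] using d(1) by (simp add: algebra_simps)
      finally show ?thesis .
    qed
    then show "\<exists>d>0. \<forall>v\<in>X. \<forall>h. norm v < d \<longrightarrow> 0 < h \<longrightarrow> h < d \<longrightarrow> norm (dq G a v h - y) \<le> e"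
      using d(1) by blast
  qed
  then show ?thesis ..
qed

lemma norm_add_scaleR_less:
  fixes v x :: "'a::real_normed_vector"
  assumes "norm v < d / (1 + norm x)" "0 < h" "h < d / (1 + norm x)"
  shows "norm (v + h *\<^sub>R x) < d"
proof -
  have pos: "0 < 1 + norm x"
    by (simp add: add_pos_nonneg)
  have "norm (v + h *\<^sub>R x) \<le> norm v + h * norm x"
    using norm_triangle_ineq[of v "h *\<^sub>R x"] assms by simp
  also have "\<dots> < d / (1 + norm x) + d / (1 + norm x) * norm x"
    using assms by (intro add_less_le_mono mult_right_mono) auto
  also have "\<dots> = (1 + norm x) * (d / (1 + norm x))"
    by (simp only: distrib_right mult_1_left mult.commute)
  also have "\<dots> = d"
    using pos by (metis less_irrefl nonzero_mult_div_cancel_left times_divide_eq_right)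
  finally show ?thesis .
qed

text \<open>
  A step \<open>h (x + x')\<close> from \<open>v\<close> is a step \<open>h x\<close> followed by a step \<open>h x'\<close> from the base point
  \<open>v + h x\<close>, which is close to the origin as well.
\<close>

lemma strict_derivative_add:
  assumes x: "x \<in> X" and "strict_derivative G x y" and "strict_derivative G x' y'"
  shows "strict_derivative G (x + x') (y + y')"
proof (rule strict_derivativeI)
  fix e :: real assume "e > 0"
  then have "e / 2 > 0"
    by simp
  obtain d where "d > 0" and
    d: "\<And>v h. v \<in> X \<Longrightarrow> norm v < d \<Longrightarrow> 0 < h \<Longrightarrow> h < d \<Longrightarrow> norm (dq G x v h - y) \<le> e / 2"
    using strict_derivativeE[OF assms(2) \<open>e / 2 > 0\<close>] by blast
  obtain d' where "d' > 0" and
    d': "\<And>v h. v \<in> X \<Longrightarrow> norm v < d' \<Longrightarrow> 0 < h \<Longrightarrow> h < d' \<Longrightarrow> norm (dq G x' v h - y') \<le> e / 2"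
    using strict_derivativeE[OF assms(3) \<open>e / 2 > 0\<close>] by blast
  define c where "c = min d (d' / (1 + norm x))"
  have c: "c > 0" "c \<le> d" "c \<le> d' / (1 + norm x)" "d' / (1 + norm x) \<le> d'"
    using \<open>d > 0\<close> \<open>d' > 0\<close> by (auto simp: c_def add_pos_nonneg divide_le_eq mult_le_cancel_left1)
  have "norm (dq G (x + x') v h - (y + y')) \<le> e" if v: "v \<in> X" "norm v < c" and h: "0 < h" "h < c" for v h
  proof -
    have "dq G (x + x') v h = dq G x v h + dq G x' (v + h *\<^sub>R x) h"
      by (simp add: dq_def scaleR_add_right add.assoc flip: scaleR_right_distrib)
    then have split: "dq G (x + x') v h - (y + y') = (dq G x v h - y) + (dq G x' (v + h *\<^sub>R x) h - y')"
      by simp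
    have "norm (dq G x v h - y) \<le> e / 2"
      using v h c by (intro d) auto
    moreover have "norm (dq G x' (v + h *\<^sub>R x) h - y') \<le> e / 2"
      using v h c x by (intro d' norm_add_scaleR_less X_closed) auto
    ultimately show ?thesis
      unfolding split by (intro norm_triangle_le) simp
  qed
  then show "\<exists>d>0. \<forall>v\<in>X. \<forall>h. norm v < d \<longrightarrow> 0 < h \<longrightarrow> h < d \<longrightarrow> norm (dq G (x + x') v h - (y + y')) \<le> e"
    using c(1) by blast
qed

lemma strict_derivative_pos_scale:
  assumes "strict_derivative G x y" and r: "r > 0"
  shows "strict_derivative G (r *\<^sub>R x) (r *\<^sub>R y)"
proof (rule strict_derivativeI)
  fix e :: real assume "e > 0"
  then have "e / r > 0"
    using r by simp
  then obtain d where "d > 0" and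
    d: "\<And>v h. v \<in> X \<Longrightarrow> norm v < d \<Longrightarrow> 0 < h \<Longrightarrow> h < d \<Longrightarrow> norm (dq G x v h - y) \<le> e / r"
    using strict_derivativeE[OF assms(1)] by blast
  define c where "c = min d (d / r)"
  have c: "c > 0" "c \<le> d" "c \<le> d / r"
    using \<open>d > 0\<close> r by (auto simp: c_def)
  have "norm (dq G (r *\<^sub>R x) v h - r *\<^sub>R y) \<le> e" if v: "v \<in> X" "norm v < c" and h: "0 < h" "h < c" for v h
  proof -
    have "dq G (r *\<^sub>R x) v h - r *\<^sub>R y = r *\<^sub>R (dq G x v (r * h) - y)"
      using r h by (simp add: dq_def scaleR_right_diff_distrib mult.commute)
    moreover have "r * h < d"
    proof -
      have "r * h < r * c"
        using h r by simp
      also have "r * c \<le> d"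
        using c(3) r by (simp add: pos_le_divide_eq mult.commute)
      finally show ?thesis .
    qed
    then have "norm (dq G x v (r * h) - y) \<le> e / r"
      using v h c r by (intro d) auto
    ultimately show ?thesis
      using r by (simp add: pos_le_divide_eq mult.commute)
  qed
  then show "\<exists>d>0. \<forall>v\<in>X. \<forall>h. norm v < d \<longrightarrow> 0 < h \<longrightarrow> h < d \<longrightarrow> norm (dq G (r *\<^sub>R x) v h - r *\<^sub>R y) \<le> e"
    using c(1) by blast
qed

text \<open>
  A step \<open>- h x\<close> from \<open>v\<close> is, reversed, a step \<open>h x\<close> from the base point \<open>v - h x\<close>.
\<close>

lemma strict_derivative_minus:
  assumes x: "x \<in> X" and "strict_derivative G x y"
  shows "strict_derivative G (- x) (- y)"
proof (rule strict_derivativeI)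
  fix e :: real assume "e > 0"
  then obtain d where "d > 0" and
    d: "\<And>v h. v \<in> X \<Longrightarrow> norm v < d \<Longrightarrow> 0 < h \<Longrightarrow> h < d \<Longrightarrow> norm (dq G x v h - y) \<le> e"
    using strict_derivativeE[OF assms(2)] by blast
  define c where "c = d / (1 + norm (- x))"
  have c: "c > 0" "c \<le> d"
    using \<open>d > 0\<close> by (auto simp: c_def add_pos_nonneg divide_le_eq mult_le_cancel_left1)
  have "norm (dq G (- x) v h - - y) \<le> e" if v: "v \<in> X" "norm v < c" and h: "0 < h" "h < c" for v h
  proof -
    have "dq G (- x) v h - - y = - (dq G x (v + h *\<^sub>R (- x)) h - y)"
      by (simp add: dq_def scaleR_right_diff_distrib)
    moreover have "norm (dq G x (v + h *\<^sub>R (- x)) h - y) \<le> e"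
      using v h c x unfolding c_def by (intro d norm_add_scaleR_less X_closed) auto
    ultimately show ?thesis
      by (simp only: norm_minus_cancel)
  qed
  then show "\<exists>d>0. \<forall>v\<in>X. \<forall>h. norm v < d \<longrightarrow> 0 < h \<longrightarrow> h < d \<longrightarrow> norm (dq G (- x) v h - - y) \<le> e"
    using c(1) by blast
qed

lemma strict_derivative_scale:
  assumes x: "x \<in> X" and y: "strict_derivative G x y"
  shows "strict_derivative G (r *\<^sub>R x) (r *\<^sub>R y)"
proof (cases r "0 :: real" rule: linorder_cases)
  case less
  then have "strict_derivative G ((- r) *\<^sub>R x) ((- r) *\<^sub>R y)"
    by (intro strict_derivative_pos_scale y) simp
  from strict_derivative_minus[OF _ this] show ?thesis
    using x by simp
next
  case equal
  have "strict_derivative G 0 0"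
    by (rule strict_derivativeI) (auto simp: dq_def intro!: exI[of _ 1])
  then show ?thesis
    using equal by simp
qed (use strict_derivative_pos_scale y in auto)

lemma norm_dq_diff:
  assumes "G \<in> isos" "x \<in> X" "x' \<in> X" "v \<in> X" "h > 0"
  shows "norm (dq G x v h - dq G x' v h) = norm (x - x')"
proof -
  have "dq G x v h - dq G x' v h = (1 / h) *\<^sub>R (G (v + h *\<^sub>R x) - G (v + h *\<^sub>R x'))"
    by (simp add: dq_def flip: scaleR_right_diff_distrib)
  also have "norm \<dots> = (1 / h) * norm (G (v + h *\<^sub>R x) - G (v + h *\<^sub>R x'))"
    using assms by simp
  also have "norm (G (v + h *\<^sub>R x) - G (v + h *\<^sub>R x')) = norm (h *\<^sub>R (x - x'))"
    using assms by (simp only: isos_norm X_closed) (simp add: scaleR_right_diff_distrib)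
  finally show ?thesis
    using assms by simp
qed

text \<open>
  For an isometric \<open>G\<close> the difference quotients, hence the derivatives, depend isometrically on the
  direction. So the derivatives along \<open>xs k\<close> converge, uniformly in base point and step.
\<close>

lemma strict_derivative_limit:
  assumes G: "G \<in> isos" and xs: "\<And>k. xs k \<in> X" "xs \<longlonglongrightarrow> x" and ys: "\<And>k. strict_derivative G (xs k) (ys k)"
  shows "\<exists>y. strict_derivative G x y"
proof -
  have x: "x \<in> X"
    using closed_sequentially[OF X(2) xs] .
  have "norm (ys k - ys l) \<le> norm (xs k - xs l)" for k l
  proof (rule LIMSEQ_le_const2)
    show "(\<lambda>m. norm (dq G (xs k) 0 (inverse (real (Suc m))) - dq G (xs l) 0 (inverse (real (Suc m)))))
        \<longlonglongrightarrow> norm (ys k - ys l)"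
      by (intro tendsto_norm tendsto_diff strict_derivative_imp_limit ys)
  qed (simp add: norm_dq_diff[OF G xs(1) xs(1)])
  moreover have "Cauchy xs"
    by (rule LIMSEQ_imp_Cauchy[OF xs(2)])
  ultimately have "Cauchy ys"
    unfolding Cauchy_def dist_norm by (meson le_less_trans)
  then obtain y where y: "ys \<longlonglongrightarrow> y"
    using Cauchy_convergent convergent_def by blast
  have "strict_derivative G x y"
  proof (rule strict_derivativeI)
    fix e :: real assume "e > 0"
    have "\<forall>\<^sub>F k in sequentially. dist (xs k) x < e / 3" "\<forall>\<^sub>F k in sequentially. dist (ys k) y < e / 3"
      using tendstoD[OF xs(2), of "e / 3"] tendstoD[OF y, of "e / 3"] \<open>e > 0\<close> by simp_all
    then have "\<forall>\<^sub>F k in sequentially. dist (xs k) x < e / 3 \<and> dist (ys k) y < e / 3"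
      by (rule eventually_conj)
    then obtain k where k: "dist (xs k) x < e / 3" "dist (ys k) y < e / 3"
      by (auto simp: eventually_sequentially)
    obtain d where "d > 0" and
      d: "\<And>v h. v \<in> X \<Longrightarrow> norm v < d \<Longrightarrow> 0 < h \<Longrightarrow> h < d \<Longrightarrow> norm (dq G (xs k) v h - ys k) \<le> e / 3"
      using strict_derivativeE[OF ys, of "e / 3" k] \<open>e > 0\<close> by auto
    have "norm (dq G x v h - y) \<le> e" if "v \<in> X" "norm v < d" "0 < h" "h < d" for v h
    proof -
      have "dist (dq G x v h) (dq G (xs k) v h) \<le> e / 3"
        using norm_dq_diff[OF G xs(1) x that(1,3), of k] k(1) by (simp add: dist_norm norm_minus_commute)
      moreover have "dist (dq G (xs k) v h) (ys k) \<le> e / 3"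
        using d[OF that] by (simp add: dist_norm)
      ultimately have "dist (dq G x v h) y \<le> e"
        using k(2) dist_triangle[of "dq G x v h" y "dq G (xs k) v h"]
          dist_triangle[of "dq G (xs k) v h" y "ys k"] by linarith
      then show ?thesis
        by (simp add: dist_norm)
    qed
    then show "\<exists>d>0. \<forall>v\<in>X. \<forall>h. norm v < d \<longrightarrow> 0 < h \<longrightarrow> h < d \<longrightarrow> norm (dq G x v h - y) \<le> e"
      using \<open>d > 0\<close> by blast
  qed
  then show ?thesis ..
qed

proposition ex_real_linear_isos:
  assumes F: "F \<in> isos" and sep: "separable_space (top_of_set X)"
  shows "\<exists>R\<in>isos. real_linear_on X R"
proof -
  obtain C where "countable C" "C \<subseteq> X" and C: "top_of_set X closure_of C = X"
    using sep unfolding separable_space_def by auto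
  have dense: "X \<subseteq> closure C"
    using C \<open>C \<subseteq> X\<close> by (auto simp: closure_of_subtopology Int_absorb1)
  then have "C \<noteq> {}"
    using X_closed(4) by auto
  then obtain c :: "nat \<Rightarrow> 'h \<Rightarrow>\<^sub>L 'h" where c: "range c = C"
    using range_from_nat_into[OF _ \<open>countable C\<close>] by blast
  \<comment> \<open>the directions \<open>c k\<close> are shortened so that their norms become summable\<close>
  define s where "s k = (1/2)^k / (1 + norm (c k))" for k
  define a where "a k = s k *\<^sub>R c k" for k
  have c_X: "c k \<in> X" for k
    using c \<open>C \<subseteq> X\<close> by auto
  have pos: "0 < 1 + norm (c k)" for k
    by (simp add: add_pos_nonneg)
  have s: "s k > 0" for k
    using pos by (simp add: s_def)
  have a_X: "a k \<in> X" for k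
    using c_X by (simp add: a_def)
  have small: "norm (a k) \<le> (1/2)^k" for k
  proof -
    have "norm (a k) = (1/2)^k * (norm (c k) / (1 + norm (c k)))"
      using s[of k] by (simp add: a_def s_def)
    also have "\<dots> \<le> (1/2)^k * 1"
      using pos[of k] by (intro mult_left_mono) (auto simp: divide_le_eq)
    finally show ?thesis
      by simp
  qed
  obtain G where G: "G \<in> isos" and G_dq: "\<And>k. \<exists>K. lipschitz_dq G (a k) K"
    using ex_isos_lipschitz_dq[where a = a, OF F a_X small] by blast
  have "\<exists>y. strict_derivative G (a k) y" for k
    using G_dq[of k] ex_strict_derivative by blast
  then obtain b where "\<And>k. strict_derivative G (a k) (b k)"
    by metis
  then have "strict_derivative G ((1 / s k) *\<^sub>R a k) ((1 / s k) *\<^sub>R b k)" for k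
    using a_X by (intro strict_derivative_scale)
  moreover have "(1 / s k) *\<^sub>R a k = c k" for k
    using s[of k] by (simp add: a_def)
  ultimately have on_c: "strict_derivative G (c k) ((1 / s k) *\<^sub>R b k)" for k
    by (simp only:)
  have "\<exists>y. strict_derivative G x y" if "x \<in> X" for x
  proof -
    have "x \<in> closure C"
      using \<open>x \<in> X\<close> dense by blast
    then obtain xs where xs: "\<forall>m. xs m \<in> C" and lim: "xs \<longlonglongrightarrow> x"
      unfolding closure_sequential by auto
    have "\<exists>k. xs m = c k" for m
      using xs[rule_format, of m] c by auto
    then obtain k where k: "\<And>m. xs m = c (k m)"
      by metis
    show ?thesis
    proof (rule strict_derivative_limit[OF G _ lim])
      show "strict_derivative G (xs m) ((1 / s (k m)) *\<^sub>R b (k m))" for m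
        unfolding k by (rule on_c)
    qed (simp add: k c_X)
  qed
  then obtain R where R: "\<And>x. x \<in> X \<Longrightarrow> strict_derivative G x (R x)"
    by metis
  have "R \<in> isos"
  proof (rule pointwise_limit_isos)
    show "(\<lambda>x. dq G x 0 (inverse (real (Suc m)))) \<in> isos" for m
      by (rule dq_isos[OF G]) simp
  qed (rule strict_derivative_imp_limit[OF R])
  moreover have "real_linear_on X R"
    unfolding real_linear_on_def
  proof (intro conjI ballI allI)
    fix x y assume x: "x \<in> X" and y: "y \<in> X"
    show "R (x + y) = R x + R y"
      using strict_derivative_unique[OF R strict_derivative_add[OF x R[OF x] R[OF y]]] x y by simp
  next
    fix r :: real and x assume x: "x \<in> X"
    show "R (r *\<^sub>R x) = r *\<^sub>R R x"
      using strict_derivative_unique[OF R strict_derivative_scale[OF x R[OF x]]] x by simp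
  qed
  ultimately show ?thesis
    by blast
qed

end

theorem theorem1p5:
  fixes X :: "('h::chilbert_space \<Rightarrow>\<^sub>L 'h) set"
    and Y :: "('k::chilbert_space \<Rightarrow>\<^sub>L 'k) set"
  assumes "operator_space X"
    and "separable_space (top_of_set X)"
    and "operator_space Y"
    and "almost_completely_isometrically_embeds X Y"
  shows "almost_completely_real_linearly_isometrically_embeds X Y"
proof -
  obtain f :: "nat \<Rightarrow> ('h \<Rightarrow>\<^sub>L 'h) \<Rightarrow> ('k \<Rightarrow>\<^sub>L 'k)"
    where f: "\<And>n. n \<ge> 1 \<Longrightarrow> f n \<in> X \<rightarrow> Y \<and> amplification_isometric n X (f n)"
    using assms(4) unfolding almost_completely_isometrically_embeds_def by blast
  have "\<exists>R. R \<in> X \<rightarrow> Y \<and> amplification_isometric n X R \<and> real_linear_on X R" if "n \<ge> 1" for n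
  proof -
    interpret amplified_isometries n X Y
      using that assms(1,3) operator_space_subspace[OF assms(1)] operator_space_subspace[OF assms(3)]
      by unfold_locales (auto simp: operator_space_def)
    have "f n \<in> isos"
      using f[OF that] by (simp add: isos_def)
    from ex_real_linear_isos[OF this assms(2)] show ?thesis
      by (auto simp: isos_def)
  qed
  then show ?thesis
    unfolding almost_completely_real_linearly_isometrically_embeds_def by metis
qed

end
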